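(* Let $\mathcal H_1=\{H_1^y\}$ and $\mathcal H_2=\{H_2^y\}$ be two ramification data over an effective divisor $D=\sum_yd_y[y]$ with $H_1^y\subset H_2^y$ for all $y\in\operatorname{supp}D$, let $K^1,K^2\subset G(\mathbb A)$ be the corresponding compact open subgroups, and let $\Gamma_D^{\mathcal H_1},\Gamma_D^{\mathcal H_2}$ be the corresponding Hecke graphs at $x$ for a dominant cocharacter $\mu$. Assume that the map $$K_x^1\Delta_xK_x^1/K_x^1\longrightarrow K_x^2\Delta_xK_x^2/K_x^2$$ induced by inclusion is a bijection. Then for any vertices $a,b\in\Gamma_D^{\mathcal H_2}$ and any lift $\tilde a\in\Gamma_D^{\mathcal H_1}$ of $a$, the surjective map $\Gamma_D^{\mathcal H_1}\to\Gamma_D^{\mathcal H_2}$ (extending the $H_1^y$-reductions to $H_2^y$ for every $y\in\operatorname{supp}D$) induces a bijection between the set of edges $a\to b$ and the set of edges from $\tilde a$ to all possible lifts of $b$ to $\Gamma_D^{\mathcal H_1}$.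
   Context: $X$ is a smooth projective geometrically connected curve over a finite field $k$ with function field $F$ and adele ring $\mathbb A$; $x$ is a fixed closed point. For a closed point $y$, $\mathcal O_y$ is the completed local ring and $\pi_y$ a uniformizer. $G$ is a connected split reductive group over $k$ with split maximal torus $T$, and $\mu$ is a dominant cocharacter of $T$. A ramification datum over $D$ is a choice of an algebraic subgroup $H^y\subset G$ for each $y\in\operatorname{supp}D$. The associated compact open subgroup is $K_{\mathcal H}(D)=\prod_yK_y$, where $K_y\subset G(\mathcal O_y)$ is the preimage of $H^y(\mathcal O_y/\pi_y^{d_y})$ if $y\in\operatorname{supp}D$ and $K_y=G(\mathcal O_y)$ otherwise. Hecke graph $\Gamma_D^{\mathcal H}$: with $K=K_{\mathcal H}(D)$, the vertices are $G(F)\backslash G(\mathbb A)/K$ (equivalently, isomorphism classes of $G$-bundles on $X$ with a reduction to $H^y$ over $\mathcal O_y/\pi_y^{d_y}$ for every $y\in\operatorname{supp}D$). Let $\Delta\in G(\mathbb A)$ have $\Delta_x=\mu(\pi_x)$ and $\Delta_y=1$ for $y\neq x$. The edges out of the class of $g$ are indexed by cosets $\sigma K\in K\Delta K/K$ (equivalently $K_x\Delta_xK_x/K_x$), the edge $\sigma K$ going to the class of $g\sigma$ (multiple edges allowed). For $\mathcal H_1,\mathcal H_2$ as in the claim, the map on vertices is the projection $G(F)\backslash G(\mathbb A)/K^1\to G(F)\backslash G(\mathbb A)/K^2$. *)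

theory Defs
  imports
    "HOL-Algebra.Algebra"
    "HOL-Algebra.Algebraic_Closure_Type"
    "HOL-Library.Poly_Mapping"
    "Graph_Theory.Digraph"
begin

text \<open>
  Rings are records of HOL-Algebra; a \<open>k\<close>-algebra is a commutative ring \<open>R\<close> together with a
  structure map \<open>\<phi>\<close> from the type \<open>'k\<close>. Multivariate polynomials are finitely supported maps from
  monomials (finitely supported exponent vectors) to coefficients.
\<close>

type_synonym ('v, 'k) mpol = "('v \<Rightarrow>\<^sub>0 nat) \<Rightarrow>\<^sub>0 'k"

abbreviation type_ring :: "'a::comm_ring_1 ring"
  where "type_ring \<equiv> ring_of_type_algebra"

definition k_algebra :: "('r, 'm) ring_scheme \<Rightarrow> ('k::field \<Rightarrow> 'r) \<Rightarrow> bool"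
  where "k_algebra R \<phi> \<longleftrightarrow> cring R \<and> \<phi> \<in> ring_hom type_ring R"

definition pol_vars :: "('v, 'k::zero) mpol \<Rightarrow> 'v set"
  where "pol_vars f = (\<Union>m\<in>Poly_Mapping.keys f. Poly_Mapping.keys m)"

definition pol_eval ::
    "('r, 'm) ring_scheme \<Rightarrow> ('k::zero \<Rightarrow> 'r) \<Rightarrow> ('v \<Rightarrow> 'r) \<Rightarrow> ('v, 'k) mpol \<Rightarrow> 'r"
  where "pol_eval R \<phi> p f =
    (\<Oplus>\<^bsub>R\<^esub>m\<in>Poly_Mapping.keys f. \<phi> (Poly_Mapping.lookup f m) \<otimes>\<^bsub>R\<^esub>
       (\<Otimes>\<^bsub>R\<^esub>v\<in>Poly_Mapping.keys m. p v [^]\<^bsub>R\<^esub> Poly_Mapping.lookup m v))"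

definition pol_var :: "'v \<Rightarrow> ('v, 'k::comm_ring_1) mpol"
  where "pol_var v = Poly_Mapping.single (Poly_Mapping.single v 1) 1"

definition homogeneous :: "nat \<Rightarrow> ('v, 'k::zero) mpol \<Rightarrow> bool"
  where "homogeneous d f \<longleftrightarrow>
    (\<forall>m\<in>Poly_Mapping.keys f. (\<Sum>v\<in>Poly_Mapping.keys m. Poly_Mapping.lookup m v) = d)"


section \<open>Curves\<close>

text \<open>
  An integral closed subscheme \<open>X\<close> of \<open>\<P>\<^sup>N\<close> over \<open>k\<close> with function field \<open>F\<close> (the type \<open>'f\<close>, with
  structure map \<open>emb : k \<rightarrow> F\<close>) is given by its generic point \<open>(s 0 : \<dots> : s N)\<close> with coordinates
  in \<open>F\<close>: a form vanishes on \<open>X\<close> iff it vanishes at \<open>s\<close>.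
\<close>

abbreviation form :: "nat \<Rightarrow> nat \<Rightarrow> (nat, 'k::zero) mpol \<Rightarrow> bool"
  where "form N d f \<equiv> homogeneous d f \<and> pol_vars f \<subseteq> {..N}"

text \<open>Homogeneous coordinate vectors of the points of \<open>X\<close> over the algebraic closure of \<open>k\<close>.\<close>

definition geometric_points ::
    "('k::field \<Rightarrow> 'f::field) \<Rightarrow> nat \<Rightarrow> (nat \<Rightarrow> 'f) \<Rightarrow> (nat \<Rightarrow> 'k alg_closure) set"
  where "geometric_points emb N s =
    {p. (\<exists>i\<le>N. p i \<noteq> 0) \<and>
        (\<forall>d f. form N d f \<and> pol_eval type_ring emb s f = 0 \<longrightarrow> pol_eval type_ring to_ac p f = 0)}"

definition local_ring_at ::
    "('k::field \<Rightarrow> 'f::field) \<Rightarrow> nat \<Rightarrow> (nat \<Rightarrow> 'f) \<Rightarrow> (nat \<Rightarrow> 'k alg_closure) \<Rightarrow> 'f set"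
  where "local_ring_at emb N s p =
    {pol_eval type_ring emb s f / pol_eval type_ring emb s g | f g.
       \<exists>d. form N d f \<and> form N d g \<and> pol_eval type_ring to_ac p g \<noteq> 0}"

text \<open>
  A closed point of \<open>X\<close> is a Galois orbit of geometric points. It is determined by its local ring,
  a subring of \<open>F\<close>, because \<open>X\<close> is integral and separated; closed points are identified with
  their local rings.
\<close>

definition closed_points ::
    "('k::field \<Rightarrow> 'f::field) \<Rightarrow> nat \<Rightarrow> (nat \<Rightarrow> 'f) \<Rightarrow> 'f set set"
  where "closed_points emb N s = local_ring_at emb N s ` geometric_points emb N s"

abbreviation loc_ring :: "'f::field set \<Rightarrow> 'f ring"
  where "loc_ring y \<equiv> type_ring\<lparr>carrier := y\<rparr>"

text \<open>Discrete valuation rings with field of fractions the whole type.\<close>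

definition dvr :: "'f::field set \<Rightarrow> bool"
  where "dvr y \<longleftrightarrow> subring y type_ring \<and> y \<noteq> UNIV \<and>
    (\<exists>t\<in>y. \<forall>z. z \<noteq> 0 \<longrightarrow> (\<exists>u e. u \<in> Units (loc_ring y) \<and> z = u * t powi e))"

definition trdeg_one :: "('k::field \<Rightarrow> 'f::field) \<Rightarrow> bool"
  where "trdeg_one emb \<longleftrightarrow>
    (\<exists>t. (\<forall>q. q \<noteq> 0 \<longrightarrow> poly (map_poly emb q) t \<noteq> 0) \<and>
         (\<forall>z. \<exists>Q. Q \<noteq> 0 \<and> poly (map_poly (\<lambda>c. poly (map_poly emb c) t) Q) z = 0))"

definition proj_closed :: "nat \<Rightarrow> (nat \<Rightarrow> 'a::field) set \<Rightarrow> bool"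
  where "proj_closed N C \<longleftrightarrow>
    (\<exists>S. (\<forall>f\<in>S. \<exists>d. form N d f) \<and>
         C = {p. (\<exists>i\<le>N. p i \<noteq> 0) \<and> (\<forall>f\<in>S. pol_eval type_ring (\<lambda>c. c) p f = 0)})"

definition geometrically_connected ::
    "('k::field \<Rightarrow> 'f::field) \<Rightarrow> nat \<Rightarrow> (nat \<Rightarrow> 'f) \<Rightarrow> bool"
  where "geometrically_connected emb N s \<longleftrightarrow>
    \<not> (\<exists>A B. proj_closed N A \<and> proj_closed N B \<and> A \<noteq> {} \<and> B \<noteq> {} \<and> A \<inter> B = {} \<and>
             A \<union> B = geometric_points emb N s)"

text \<open>
  Over a finite (hence perfect) field a curve is smooth iff it is regular, that is, iff its local
  rings at closed points are discrete valuation rings. The third conjunct below says that \<open>F\<close> is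
  the function field of \<open>X\<close>.
\<close>

definition smooth_projective_curve ::
    "('k::{field,finite} \<Rightarrow> 'f::field) \<Rightarrow> nat \<Rightarrow> (nat \<Rightarrow> 'f) \<Rightarrow> bool"
  where "smooth_projective_curve emb N s \<longleftrightarrow>
    emb \<in> ring_hom type_ring type_ring \<and>
    (\<exists>i\<le>N. s i \<noteq> 0) \<and>
    (\<forall>z. \<exists>d f g. form N d f \<and> form N d g \<and> pol_eval type_ring emb s g \<noteq> 0 \<and>
        z = pol_eval type_ring emb s f / pol_eval type_ring emb s g) \<and>
    trdeg_one emb \<and>
    (\<forall>y\<in>closed_points emb N s. dvr y) \<and>
    geometrically_connected emb N s"

definition effective_divisor :: "'f set set \<Rightarrow> ('f set \<Rightarrow> nat) \<Rightarrow> bool"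
  where "effective_divisor Y D \<longleftrightarrow> finite {y. D y \<noteq> 0} \<and> {y. D y \<noteq> 0} \<subseteq> Y"


section \<open>Completions and adeles\<close>

definition uniformizer :: "('r, 'm) ring_scheme \<Rightarrow> 'r \<Rightarrow> bool"
  where "uniformizer R p \<longleftrightarrow> p \<in> carrier R \<and> carrier R - Units R = PIdl\<^bsub>R\<^esub> p"

definition max_ideal_pow :: "'f::field set \<Rightarrow> nat \<Rightarrow> 'f set"
  where "max_ideal_pow y i =
    {z. \<exists>t. uniformizer (loc_ring y) t \<and> z \<in> PIdl\<^bsub>loc_ring y\<^esub> (t ^ i)}"

definition cauchy_seqs :: "'f::field set \<Rightarrow> (nat \<Rightarrow> 'f) set"
  where "cauchy_seqs y = {a. \<forall>e. \<exists>M. \<forall>i\<ge>M. \<forall>j\<ge>M. a i - a j \<in> max_ideal_pow y e}"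

definition null_seqs :: "'f::field set \<Rightarrow> (nat \<Rightarrow> 'f) set"
  where "null_seqs y = {a. \<forall>e. \<exists>M. \<forall>i\<ge>M. a i \<in> max_ideal_pow y e}"

definition cauchy_ring :: "'f::field set \<Rightarrow> (nat \<Rightarrow> 'f) ring"
  where "cauchy_ring y =
    \<lparr>carrier = cauchy_seqs y, monoid.mult = (\<lambda>a b i. a i * b i), one = (\<lambda>_. 1),
     ring.zero = (\<lambda>_. 0), add = (\<lambda>a b i. a i + b i)\<rparr>"

type_synonym 'f completed = "(nat \<Rightarrow> 'f) set"

definition Fhat :: "'f::field set \<Rightarrow> 'f completed ring"
  where "Fhat y = cauchy_ring y Quot null_seqs y"

definition completed_class :: "'f::field set \<Rightarrow> (nat \<Rightarrow> 'f) \<Rightarrow> 'f completed"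
  where "completed_class y a = null_seqs y +>\<^bsub>cauchy_ring y\<^esub> a"

definition to_Fhat :: "'f::field set \<Rightarrow> 'f \<Rightarrow> 'f completed"
  where "to_Fhat y z = completed_class y (\<lambda>_. z)"

text \<open>The completed local ring, as a subring of its field of fractions \<open>Fhat y\<close>.\<close>

definition Ohat :: "'f::field set \<Rightarrow> 'f completed ring"
  where "Ohat y =
    (Fhat y)\<lparr>carrier := completed_class y ` {a \<in> cauchy_seqs y. \<forall>i. a i \<in> y}\<rparr>"

type_synonym 'f adele = "'f set \<Rightarrow> 'f completed"

definition prod_ring :: "'f::field set set \<Rightarrow> 'f adele ring"
  where "prod_ring Y =
    \<lparr>carrier = (\<Pi>\<^sub>E y\<in>Y. carrier (Fhat y)),
     monoid.mult = (\<lambda>a b. \<lambda>y\<in>Y. a y \<otimes>\<^bsub>Fhat y\<^esub> b y), one = (\<lambda>y\<in>Y. \<one>\<^bsub>Fhat y\<^esub>),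
     ring.zero = (\<lambda>y\<in>Y. \<zero>\<^bsub>Fhat y\<^esub>), add = (\<lambda>a b. \<lambda>y\<in>Y. a y \<oplus>\<^bsub>Fhat y\<^esub> b y)\<rparr>"

definition adele_ring :: "'f::field set set \<Rightarrow> 'f adele ring"
  where "adele_ring Y = (prod_ring Y)
    \<lparr>carrier := {a \<in> carrier (prod_ring Y). finite {y \<in> Y. a y \<notin> carrier (Ohat y)}}\<rparr>"

definition diag :: "'f::field set set \<Rightarrow> 'f \<Rightarrow> 'f adele"
  where "diag Y z = (\<lambda>y\<in>Y. to_Fhat y z)"


section \<open>Affine algebraic groups\<close>

abbreviation idx :: "nat \<Rightarrow> (nat \<times> nat) set"
  where "idx n \<equiv> {..<n} \<times> {..<n}"

definition Mat :: "nat \<Rightarrow> ('r, 'm) ring_scheme \<Rightarrow> (nat \<times> nat \<Rightarrow> 'r) monoid"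
  where "Mat n R =
    \<lparr>carrier = idx n \<rightarrow>\<^sub>E carrier R,
     monoid.mult = (\<lambda>A B. \<lambda>(i, j)\<in>idx n. \<Oplus>\<^bsub>R\<^esub>l\<in>{..<n}. A (i, l) \<otimes>\<^bsub>R\<^esub> B (l, j)),
     one = (\<lambda>(i, j)\<in>idx n. if i = j then \<one>\<^bsub>R\<^esub> else \<zero>\<^bsub>R\<^esub>)\<rparr>"

definition GL :: "nat \<Rightarrow> ('r, 'm) ring_scheme \<Rightarrow> (nat \<times> nat \<Rightarrow> 'r) monoid"
  where "GL n R = units_of (Mat n R)"

definition mat_map :: "nat \<Rightarrow> ('r \<Rightarrow> 's) \<Rightarrow> (nat \<times> nat \<Rightarrow> 'r) \<Rightarrow> nat \<times> nat \<Rightarrow> 's"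
  where "mat_map n h A = (\<lambda>ij\<in>idx n. h (A ij))"

text \<open>
  The coordinate ring of \<open>GL n\<close> is generated by the entries \<open>Inl (i, j)\<close> of a matrix and the entries
  \<open>Inr (i, j)\<close> of its inverse; regular functions are represented by polynomials in these.
\<close>

type_synonym 'k regfun = "(nat \<times> nat + nat \<times> nat, 'k) mpol"

definition regular_funs :: "nat \<Rightarrow> 'k::zero regfun set"
  where "regular_funs n = {f. pol_vars f \<subseteq> idx n <+> idx n}"

definition coords ::
    "nat \<Rightarrow> ('r, 'm) ring_scheme \<Rightarrow> (nat \<times> nat \<Rightarrow> 'r) \<Rightarrow> nat \<times> nat + nat \<times> nat \<Rightarrow> 'r"
  where "coords n R g v = (case v of Inl ij \<Rightarrow> g ij | Inr ij \<Rightarrow> (inv\<^bsub>GL n R\<^esub> g) ij)"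

definition fun_eval ::
    "nat \<Rightarrow> ('r, 'm) ring_scheme \<Rightarrow> ('k::zero \<Rightarrow> 'r) \<Rightarrow> 'k regfun \<Rightarrow> (nat \<times> nat \<Rightarrow> 'r) \<Rightarrow> 'r"
  where "fun_eval n R \<phi> f g = pol_eval R \<phi> (coords n R g) f"

text \<open>The \<open>R\<close>-valued points of the closed subscheme of \<open>GL n\<close> defined by the equations \<open>S\<close>.\<close>

definition pts ::
    "nat \<Rightarrow> 'k::zero regfun set \<Rightarrow> ('r, 'm) ring_scheme \<Rightarrow> ('k \<Rightarrow> 'r) \<Rightarrow> (nat \<times> nat \<Rightarrow> 'r) set"
  where "pts n S R \<phi> = {g \<in> carrier (GL n R). \<forall>f\<in>S. fun_eval n R \<phi> f g = \<zero>\<^bsub>R\<^esub>}"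

abbreviation pts_group ::
    "nat \<Rightarrow> 'k::zero regfun set \<Rightarrow> ('r, 'm) ring_scheme \<Rightarrow> ('k \<Rightarrow> 'r) \<Rightarrow> (nat \<times> nat \<Rightarrow> 'r) monoid"
  where "pts_group n S R \<phi> \<equiv> (GL n R)\<lparr>carrier := pts n S R \<phi>\<rparr>"

text \<open>
  Scheme-theoretic notions are expressed through functors of points on \<open>k\<close>-algebras with carrier in
  \<open>nat\<close>, i.e. on countable \<open>k\<close>-algebras. The fields \<open>k\<close> to which the definitions are applied (a
  finite field and its algebraic closure) are countable, so every finitely generated \<open>k\<close>-algebra is
  isomorphic to one of these, in particular the coordinate rings of the schemes in question, of
  their products and of their infinitesimal neighbourhoods. By Yoneda each condition is therefore
  equivalent to the same condition for all \<open>k\<close>-algebras.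
\<close>

definition algebraic_group :: "nat \<Rightarrow> 'k::field regfun set \<Rightarrow> bool"
  where "algebraic_group n S \<longleftrightarrow> S \<subseteq> regular_funs n \<and>
    (\<forall>(R :: nat ring) \<phi>. k_algebra R \<phi> \<longrightarrow> subgroup (pts n S R \<phi>) (GL n R))"

definition subscheme :: "nat \<Rightarrow> 'k::field regfun set \<Rightarrow> 'k regfun set \<Rightarrow> bool"
  where "subscheme n S S' \<longleftrightarrow>
    (\<forall>(R :: nat ring) \<phi>. k_algebra R \<phi> \<longrightarrow> pts n S R \<phi> \<subseteq> pts n S' R \<phi>)"

definition algebraic_subgroup :: "nat \<Rightarrow> 'k::field regfun set \<Rightarrow> 'k regfun set \<Rightarrow> bool"
  where "algebraic_subgroup n H G \<longleftrightarrow> algebraic_group n H \<and> subscheme n H G"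

text \<open>Morphisms into \<open>GL m\<close> are matrices of regular functions.\<close>

definition mor_apply ::
    "nat \<Rightarrow> nat \<Rightarrow> ('r, 'm) ring_scheme \<Rightarrow> ('k::zero \<Rightarrow> 'r) \<Rightarrow> (nat \<times> nat \<Rightarrow> 'k regfun) \<Rightarrow>
      (nat \<times> nat \<Rightarrow> 'r) \<Rightarrow> nat \<times> nat \<Rightarrow> 'r"
  where "mor_apply n m R \<phi> \<rho> g = (\<lambda>ij\<in>idx m. fun_eval n R \<phi> (\<rho> ij) g)"

definition group_mor ::
    "nat \<Rightarrow> 'k::field regfun set \<Rightarrow> nat \<Rightarrow> 'k regfun set \<Rightarrow> (nat \<times> nat \<Rightarrow> 'k regfun) \<Rightarrow> bool"
  where "group_mor n S m S' \<rho> \<longleftrightarrow> (\<forall>ij\<in>idx m. \<rho> ij \<in> regular_funs n) \<and>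
    (\<forall>(R :: nat ring) \<phi>. k_algebra R \<phi> \<longrightarrow>
       mor_apply n m R \<phi> \<rho> \<in> hom (pts_group n S R \<phi>) (pts_group m S' R \<phi>))"

definition group_iso ::
    "nat \<Rightarrow> 'k::field regfun set \<Rightarrow> nat \<Rightarrow> 'k regfun set \<Rightarrow> (nat \<times> nat \<Rightarrow> 'k regfun) \<Rightarrow> bool"
  where "group_iso n S m S' \<rho> \<longleftrightarrow> group_mor n S m S' \<rho> \<and>
    (\<forall>(R :: nat ring) \<phi>. k_algebra R \<phi> \<longrightarrow>
       mor_apply n m R \<phi> \<rho> \<in> iso (pts_group n S R \<phi>) (pts_group m S' R \<phi>))"

text \<open>Equations of the diagonal matrices in \<open>GL r\<close>, a copy of the \<open>r\<close>-th power of \<open>\<G>\<^sub>m = GL 1\<close>.\<close>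

definition diagonal_eqs :: "nat \<Rightarrow> 'k::field regfun set"
  where "diagonal_eqs r = {pol_var (Inl (i, j)) | i j. i < r \<and> j < r \<and> i \<noteq> j}"

definition split_torus :: "nat \<Rightarrow> 'k::field regfun set \<Rightarrow> bool"
  where "split_torus n T \<longleftrightarrow> algebraic_group n T \<and>
    (\<exists>r \<rho>. group_iso r (diagonal_eqs r) n T \<rho>)"

definition base_change :: "'k::field regfun set \<Rightarrow> 'k alg_closure regfun set"
  where "base_change S = Poly_Mapping.map to_ac ` S"

definition torus :: "nat \<Rightarrow> 'k::field regfun set \<Rightarrow> bool"
  where "torus n T \<longleftrightarrow> algebraic_group n T \<and> split_torus n (base_change T)"

definition maximal_torus :: "nat \<Rightarrow> 'k::field regfun set \<Rightarrow> 'k regfun set \<Rightarrow> bool"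
  where "maximal_torus n G T \<longleftrightarrow> torus n T \<and> subscheme n T G \<and>
    (\<forall>T'. torus n T' \<and> subscheme n T' G \<and> subscheme n T T' \<longrightarrow> subscheme n T' T)"

text \<open>Smoothness as the infinitesimal lifting property.\<close>

definition smooth_scheme :: "nat \<Rightarrow> 'k::field regfun set \<Rightarrow> bool"
  where "smooth_scheme n S \<longleftrightarrow>
    (\<forall>(R :: nat ring) \<phi> J. k_algebra R \<phi> \<and> ideal J R \<and> (\<forall>a\<in>J. \<forall>b\<in>J. a \<otimes>\<^bsub>R\<^esub> b = \<zero>\<^bsub>R\<^esub>) \<longrightarrow>
       pts n S (R Quot J) (\<lambda>c. J +>\<^bsub>R\<^esub> \<phi> c) \<subseteq> mat_map n (\<lambda>a. J +>\<^bsub>R\<^esub> a) ` pts n S R \<phi>)"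

definition zariski_closed :: "nat \<Rightarrow> (nat \<times> nat \<Rightarrow> 'a::field) set \<Rightarrow> bool"
  where "zariski_closed n C \<longleftrightarrow> (\<exists>S\<subseteq>regular_funs n. C = pts n S type_ring (\<lambda>c. c))"

definition zariski_connected :: "nat \<Rightarrow> (nat \<times> nat \<Rightarrow> 'a::field) set \<Rightarrow> bool"
  where "zariski_connected n C \<longleftrightarrow>
    \<not> (\<exists>A B. zariski_closed n A \<and> zariski_closed n B \<and> C \<subseteq> A \<union> B \<and>
             A \<inter> B \<inter> C = {} \<and> A \<inter> C \<noteq> {} \<and> B \<inter> C \<noteq> {})"

definition unipotent :: "nat \<Rightarrow> (nat \<times> nat \<Rightarrow> 'a::field) \<Rightarrow> bool"
  where "unipotent n g \<longleftrightarrow>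
    (\<lambda>ij\<in>idx n. g ij - \<one>\<^bsub>Mat n type_ring\<^esub> ij) [^]\<^bsub>Mat n type_ring\<^esub> n = (\<lambda>ij\<in>idx n. 0)"

text \<open>The unipotent radical over the algebraic closure is trivial.\<close>

definition trivial_geometric_unipotent_radical :: "nat \<Rightarrow> 'k::field regfun set \<Rightarrow> bool"
  where "trivial_geometric_unipotent_radical n G \<longleftrightarrow>
    (\<forall>U :: (nat \<times> nat \<Rightarrow> 'k alg_closure) set.
       U \<lhd> pts_group n G type_ring to_ac \<and> zariski_closed n U \<and> zariski_connected n U \<and>
       (\<forall>u\<in>U. unipotent n u)
       \<longrightarrow> U = {\<one>\<^bsub>GL n type_ring\<^esub>})"

definition connected_reductive :: "nat \<Rightarrow> 'k::field regfun set \<Rightarrow> bool"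
  where "connected_reductive n G \<longleftrightarrow> algebraic_group n G \<and> smooth_scheme n G \<and>
    zariski_connected n (pts n G (type_ring :: 'k alg_closure ring) to_ac) \<and>
    trivial_geometric_unipotent_radical n G"

definition split_maximal_torus :: "nat \<Rightarrow> 'k::field regfun set \<Rightarrow> 'k regfun set \<Rightarrow> bool"
  where "split_maximal_torus n G T \<longleftrightarrow> maximal_torus n G T \<and> split_torus n T"


subsection \<open>Roots and dominant cocharacters\<close>

definition character :: "nat \<Rightarrow> 'k::field regfun set \<Rightarrow> (nat \<times> nat \<Rightarrow> 'k regfun) \<Rightarrow> bool"
  where "character n T \<alpha> \<longleftrightarrow> group_mor n T 1 {} \<alpha>"

definition cocharacter :: "nat \<Rightarrow> 'k::field regfun set \<Rightarrow> (nat \<times> nat \<Rightarrow> 'k regfun) \<Rightarrow> bool"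
  where "cocharacter n T \<mu> \<longleftrightarrow> group_mor 1 {} n T \<mu>"

text \<open>\<open>\<langle>\<alpha>, \<mu>\<rangle> = e\<close>, i.e. \<open>\<alpha> (\<mu> u) = u ^ e\<close>.\<close>

definition pairing ::
    "nat \<Rightarrow> (nat \<times> nat \<Rightarrow> 'k::field regfun) \<Rightarrow> (nat \<times> nat \<Rightarrow> 'k regfun) \<Rightarrow> int \<Rightarrow> bool"
  where "pairing n \<alpha> \<mu> e \<longleftrightarrow>
    (\<forall>(R :: nat ring) \<phi>. k_algebra R \<phi> \<longrightarrow>
       (\<forall>u\<in>carrier (GL 1 R).
          mor_apply n 1 R \<phi> \<alpha> (mor_apply 1 n R \<phi> \<mu> u) = u [^]\<^bsub>GL 1 R\<^esub> e))"

definition dual_numbers :: "('k::field \<times> 'k) ring"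
  where "dual_numbers =
    \<lparr>carrier = UNIV, monoid.mult = (\<lambda>(a, b) (c, d). (a * c, a * d + b * c)), one = (1, 0),
     ring.zero = (0, 0), add = (\<lambda>(a, b) (c, d). (a + c, b + d))\<rparr>"

text \<open>The Lie algebra: matrices \<open>A\<close> such that \<open>1 + \<epsilon> A\<close> is a point over the dual numbers.\<close>

definition Lie :: "nat \<Rightarrow> 'k::field regfun set \<Rightarrow> (nat \<times> nat \<Rightarrow> 'k) set"
  where "Lie n G = {A \<in> carrier (Mat n type_ring).
    (\<lambda>ij\<in>idx n. (\<one>\<^bsub>Mat n type_ring\<^esub> ij, A ij)) \<in> pts n G dual_numbers (\<lambda>c. (c, 0))}"

definition root ::
    "nat \<Rightarrow> 'k::field regfun set \<Rightarrow> 'k regfun set \<Rightarrow> (nat \<times> nat \<Rightarrow> 'k regfun) \<Rightarrow> bool"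
  where "root n G T \<alpha> \<longleftrightarrow> character n T \<alpha> \<and>
    (\<exists>(R :: nat ring) \<phi>. k_algebra R \<phi> \<and>
       (\<exists>t\<in>pts n T R \<phi>. mor_apply n 1 R \<phi> \<alpha> t \<noteq> \<one>\<^bsub>GL 1 R\<^esub>)) \<and>
    (\<exists>A\<in>Lie n G. A \<noteq> (\<lambda>ij\<in>idx n. 0) \<and>
       (\<forall>(R :: nat ring) \<phi>. k_algebra R \<phi> \<longrightarrow> (\<forall>t\<in>pts n T R \<phi>.
          t \<otimes>\<^bsub>Mat n R\<^esub> mat_map n \<phi> A \<otimes>\<^bsub>Mat n R\<^esub> inv\<^bsub>GL n R\<^esub> t
            = mat_map n (\<lambda>c. mor_apply n 1 R \<phi> \<alpha> t (0, 0) \<otimes>\<^bsub>R\<^esub> \<phi> c) A)))"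

text \<open>
  Dominance refers to a choice of positive roots: those pairing positively with some cocharacter
  that is not orthogonal to any root.
\<close>

definition positive_system ::
    "nat \<Rightarrow> 'k::field regfun set \<Rightarrow> 'k regfun set \<Rightarrow> (nat \<times> nat \<Rightarrow> 'k regfun) set \<Rightarrow> bool"
  where "positive_system n G T P \<longleftrightarrow>
    (\<exists>\<nu>. cocharacter n T \<nu> \<and> (\<forall>\<alpha>. root n G T \<alpha> \<longrightarrow> \<not> pairing n \<alpha> \<nu> 0) \<and>
         P = {\<alpha>. root n G T \<alpha> \<and> (\<exists>e>0. pairing n \<alpha> \<nu> e)})"

definition dominant_cocharacter ::
    "nat \<Rightarrow> 'k::field regfun set \<Rightarrow> (nat \<times> nat \<Rightarrow> 'k regfun) set \<Rightarrow>
      (nat \<times> nat \<Rightarrow> 'k regfun) \<Rightarrow> bool"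
  where "dominant_cocharacter n T P \<mu> \<longleftrightarrow> cocharacter n T \<mu> \<and>
    (\<forall>\<alpha>\<in>P. \<forall>e. pairing n \<alpha> \<mu> e \<longrightarrow> 0 \<le> e)"


section \<open>Level structures and Hecke graphs\<close>

definition ramification_datum ::
    "nat \<Rightarrow> 'k::field regfun set \<Rightarrow> ('f set \<Rightarrow> nat) \<Rightarrow> ('f set \<Rightarrow> 'k regfun set) \<Rightarrow> bool"
  where "ramification_datum n G D H \<longleftrightarrow> (\<forall>y. D y \<noteq> 0 \<longrightarrow> algebraic_subgroup n (H y) G)"

text \<open>
  Products in \<open>G(\<A>)\<close> are formed in \<open>GL n\<close> of the product of all completions, of which the adele
  ring is a subring; this group also contains \<open>G(F)\<close>, embedded diagonally.
\<close>

abbreviation ambient :: "nat \<Rightarrow> 'f::field set set \<Rightarrow> (nat \<times> nat \<Rightarrow> 'f adele) monoid"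
  where "ambient n Y \<equiv> GL n (prod_ring Y)"

definition adelic_points ::
    "nat \<Rightarrow> 'k::field regfun set \<Rightarrow> ('k \<Rightarrow> 'f::field) \<Rightarrow> 'f set set \<Rightarrow> (nat \<times> nat \<Rightarrow> 'f adele) set"
  where "adelic_points n G emb Y = pts n G (adele_ring Y) (\<lambda>c. diag Y (emb c))"

definition rational_points ::
    "nat \<Rightarrow> 'k::field regfun set \<Rightarrow> ('k \<Rightarrow> 'f::field) \<Rightarrow> 'f set set \<Rightarrow> (nat \<times> nat \<Rightarrow> 'f adele) set"
  where "rational_points n G emb Y = mat_map n (diag Y) ` pts n G type_ring emb"

definition component :: "nat \<Rightarrow> 'f set \<Rightarrow> (nat \<times> nat \<Rightarrow> 'f adele) \<Rightarrow> nat \<times> nat \<Rightarrow> 'f completed"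
  where "component n y g = mat_map n (\<lambda>a. a y) g"

text \<open>The local factor \<open>K\<^sub>y\<close> of the level group.\<close>

definition local_level ::
    "nat \<Rightarrow> 'k::field regfun set \<Rightarrow> ('k \<Rightarrow> 'f::field) \<Rightarrow> ('f set \<Rightarrow> 'f completed) \<Rightarrow>
      ('f set \<Rightarrow> nat) \<Rightarrow> ('f set \<Rightarrow> 'k regfun set) \<Rightarrow> 'f set \<Rightarrow> (nat \<times> nat \<Rightarrow> 'f completed) set"
  where "local_level n G emb \<pi> D H y =
    (let GO = pts n G (Ohat y) (\<lambda>c. to_Fhat y (emb c));
         J = PIdl\<^bsub>Ohat y\<^esub> (\<pi> y [^]\<^bsub>Ohat y\<^esub> D y)
     in if D y = 0 then GO
        else {g \<in> GO. mat_map n (\<lambda>a. J +>\<^bsub>Ohat y\<^esub> a) g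
                \<in> pts n (H y) (Ohat y Quot J) (\<lambda>c. J +>\<^bsub>Ohat y\<^esub> to_Fhat y (emb c))})"

definition level_group ::
    "nat \<Rightarrow> 'k::field regfun set \<Rightarrow> ('k \<Rightarrow> 'f::field) \<Rightarrow> 'f set set \<Rightarrow> ('f set \<Rightarrow> 'f completed) \<Rightarrow>
      ('f set \<Rightarrow> nat) \<Rightarrow> ('f set \<Rightarrow> 'k regfun set) \<Rightarrow> (nat \<times> nat \<Rightarrow> 'f adele) set"
  where "level_group n G emb Y \<pi> D H =
    {g \<in> adelic_points n G emb Y. \<forall>y\<in>Y. component n y g \<in> local_level n G emb \<pi> D H y}"

text \<open>\<open>\<mu>(\<pi>\<^sub>x)\<close> in \<open>G(F\<^sub>x)\<close>, where \<open>\<pi>\<^sub>x\<close> is regarded as an element of \<open>\<G>\<^sub>m(F\<^sub>x) = GL 1 (Fhat x)\<close>.\<close>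

definition local_hecke ::
    "nat \<Rightarrow> ('k::field \<Rightarrow> 'f::field) \<Rightarrow> ('f set \<Rightarrow> 'f completed) \<Rightarrow> 'f set \<Rightarrow>
      (nat \<times> nat \<Rightarrow> 'k regfun) \<Rightarrow> nat \<times> nat \<Rightarrow> 'f completed"
  where "local_hecke n emb \<pi> x \<mu> =
    mor_apply 1 n (Fhat x) (\<lambda>c. to_Fhat x (emb c)) \<mu> (\<lambda>ij\<in>idx 1. \<pi> x)"

definition adelic_hecke ::
    "nat \<Rightarrow> ('k::field \<Rightarrow> 'f::field) \<Rightarrow> 'f set set \<Rightarrow> ('f set \<Rightarrow> 'f completed) \<Rightarrow> 'f set \<Rightarrow>
      (nat \<times> nat \<Rightarrow> 'k regfun) \<Rightarrow> nat \<times> nat \<Rightarrow> 'f adele"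
  where "adelic_hecke n emb Y \<pi> x \<mu> =
    (\<lambda>ij\<in>idx n. \<lambda>y\<in>Y. if y = x then local_hecke n emb \<pi> x \<mu> ij else \<one>\<^bsub>Mat n (Fhat y)\<^esub> ij)"

text \<open>The set \<open>K \<Delta> K / K\<close> of left cosets \<open>\<sigma> K\<close> with \<open>\<sigma> \<in> K \<Delta> K\<close>.\<close>

definition hecke_cosets :: "('g, 'm) monoid_scheme \<Rightarrow> 'g set \<Rightarrow> 'g \<Rightarrow> 'g set set"
  where "hecke_cosets A K \<Delta> = (\<lambda>\<sigma>. \<sigma> <#\<^bsub>A\<^esub> K) ` (K <#>\<^bsub>A\<^esub> {\<Delta>} <#>\<^bsub>A\<^esub> K)"

type_synonym 'f vertex = "(nat \<times> nat \<Rightarrow> 'f adele) set"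
type_synonym 'f edge = "'f vertex \<times> (nat \<times> nat \<Rightarrow> 'f adele) set"

definition hecke_vertices ::
    "nat \<Rightarrow> 'k::field regfun set \<Rightarrow> ('k \<Rightarrow> 'f::field) \<Rightarrow> 'f set set \<Rightarrow>
      (nat \<times> nat \<Rightarrow> 'f adele) set \<Rightarrow> 'f vertex set"
  where "hecke_vertices n G emb Y K =
    (\<lambda>g. rational_points n G emb Y <#>\<^bsub>ambient n Y\<^esub> {g} <#>\<^bsub>ambient n Y\<^esub> K)
      ` adelic_points n G emb Y"

text \<open>
  Indexing the edges out of a vertex by the cosets \<open>\<sigma> K\<close> requires a representative \<open>g\<close> of that
  vertex. The Hecke graph is formed with respect to a choice \<open>rep\<close> of representatives; changing the
  representative from \<open>g\<close> to \<open>\<gamma> g \<kappa>\<close> relabels the edges by left translation with \<open>\<kappa>\<^sup>-\<^sup>1\<close>.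
\<close>

definition representatives ::
    "nat \<Rightarrow> 'k::field regfun set \<Rightarrow> ('k \<Rightarrow> 'f::field) \<Rightarrow> 'f set set \<Rightarrow>
      (nat \<times> nat \<Rightarrow> 'f adele) set \<Rightarrow> ('f vertex \<Rightarrow> nat \<times> nat \<Rightarrow> 'f adele) \<Rightarrow> bool"
  where "representatives n G emb Y K rep \<longleftrightarrow>
    (\<forall>a\<in>hecke_vertices n G emb Y K. rep a \<in> a \<inter> adelic_points n G emb Y)"

text \<open>
  The edge labelled \<open>\<sigma> K\<close> out of the class \<open>a\<close> of \<open>g = rep a\<close> ends in the class of \<open>g \<sigma>\<close>, which as a
  set is the product of \<open>G(F)\<close> with the coset \<open>g \<sigma> K\<close>.
\<close>

definition hecke_graph ::
    "nat \<Rightarrow> 'k::field regfun set \<Rightarrow> ('k \<Rightarrow> 'f::field) \<Rightarrow> 'f set set \<Rightarrow>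
      (nat \<times> nat \<Rightarrow> 'f adele) set \<Rightarrow> (nat \<times> nat \<Rightarrow> 'f adele) \<Rightarrow>
      ('f vertex \<Rightarrow> nat \<times> nat \<Rightarrow> 'f adele) \<Rightarrow> ('f vertex, 'f edge) pre_digraph"
  where "hecke_graph n G emb Y K \<Delta> rep =
    \<lparr>verts = hecke_vertices n G emb Y K,
     arcs = hecke_vertices n G emb Y K \<times> hecke_cosets (ambient n Y) K \<Delta>,
     tail = fst,
     head = (\<lambda>(a, C). rational_points n G emb Y <#>\<^bsub>ambient n Y\<^esub> (rep a <#\<^bsub>ambient n Y\<^esub> C))\<rparr>"

text \<open>For \<open>K \<subseteq> K'\<close>: the projection sending the class of \<open>g\<close> modulo \<open>K\<close> to its class modulo \<open>K'\<close>.\<close>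

definition vertex_map ::
    "nat \<Rightarrow> 'f::field set set \<Rightarrow> (nat \<times> nat \<Rightarrow> 'f adele) set \<Rightarrow> 'f vertex \<Rightarrow> 'f vertex"
  where "vertex_map n Y K' a = a <#>\<^bsub>ambient n Y\<^esub> K'"

text \<open>
  The induced map on edges. If the chosen representatives \<open>g\<close> of \<open>a\<close> and \<open>g'\<close> of its image satisfy
  \<open>g = \<gamma> g' \<kappa>\<close> with \<open>\<gamma> \<in> G(F)\<close> and \<open>\<kappa> \<in> K'\<close>, then \<open>g \<sigma> = \<gamma> g' (\<kappa> \<sigma>)\<close>, so the edge labelled
  \<open>\<sigma> K\<close> goes to the edge labelled \<open>\<kappa> \<sigma> K'\<close>.
\<close>

definition transports ::
    "nat \<Rightarrow> 'k::field regfun set \<Rightarrow> ('k \<Rightarrow> 'f::field) \<Rightarrow> 'f set set \<Rightarrow>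
      (nat \<times> nat \<Rightarrow> 'f adele) set \<Rightarrow> (nat \<times> nat \<Rightarrow> 'f adele) \<Rightarrow> (nat \<times> nat \<Rightarrow> 'f adele) \<Rightarrow>
      (nat \<times> nat \<Rightarrow> 'f adele) set"
  where "transports n G emb Y K' g g' =
    {\<kappa> \<in> K'. \<exists>\<gamma>\<in>rational_points n G emb Y. g = \<gamma> \<otimes>\<^bsub>ambient n Y\<^esub> g' \<otimes>\<^bsub>ambient n Y\<^esub> \<kappa>}"

definition edge_map ::
    "nat \<Rightarrow> 'f::field set set \<Rightarrow> (nat \<times> nat \<Rightarrow> 'f adele) set \<Rightarrow> (nat \<times> nat \<Rightarrow> 'f adele) \<Rightarrow>
      'f edge \<Rightarrow> 'f edge"
  where "edge_map n Y K' \<kappa> = (\<lambda>(a, C).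
    (vertex_map n Y K' a, \<kappa> <#\<^bsub>ambient n Y\<^esub> (C <#>\<^bsub>ambient n Y\<^esub> K')))"

end

theory Submission
  imports Defs
begin

text \<open>
  The edges out of a vertex are labelled by \<open>K \<Delta> K / K\<close>. Since \<open>\<Delta>\<close> is trivial away from \<open>x\<close> and
  \<open>K\<close> is a product of local factors, projecting to the component at \<open>x\<close> identifies this set with
  \<open>K\<^sub>x \<Delta>\<^sub>x K\<^sub>x / K\<^sub>x\<close>; so the local bijection in the hypothesis is the global bijection
  \<open>\<sigma> K\<^sup>1 \<mapsto> \<sigma> K\<^sup>2\<close>. Changing the representative of a vertex translates labels by an element of \<open>K\<^sup>2\<close>,
  which permutes the cosets in \<open>K\<^sup>2 \<Delta> K\<^sup>2\<close>, and the edges labelled \<open>\<sigma> K\<^sup>1\<close> and \<open>\<sigma> K\<^sup>2\<close> end in a vertex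
  and in its image, so the bijection restricts to the edges over a fixed target.

  The definitions express group schemes through \<open>k\<close>-algebras with carrier in \<open>nat\<close>. The completions and
  the adele ring are uncountable, but any countably many points over them already live over a countable
  subalgebra, so the group axioms, inclusions and morphisms extend to all \<open>k\<close>-algebras.
\<close>

section \<open>Hecke cosets in abstract groups\<close>

text \<open>All products are taken in GL_n of the full product of the completions. A level group
  consists of matrices whose components, together with the inverses of these, are integral at every
  closed point. The finiteness condition in the definition of adeles is then automatic, and the
  level group is cut out of the ambient group by one condition per point. This is what makes the
  comparison at \<open>x\<close> work: a local element extends by the identity at all other points,
  which gives surjectivity, and two labels with the same component agree because their
  representatives k \<Delta> already satisfy the conditions at the other points. The curve enters
  through two facts. Its local rings are discrete valuation rings, so the completions are rings in
  which a uniformizer becomes invertible; otherwise \<mu> could not be evaluated at it. They also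
  contain the constants, so the completed local rings are k-algebras. The lifts of b are never
  enumerated: an edge ends over b exactly when its head, multiplied on the right by K^2, equals
  b.\<close>

lemma (in group) lcos_absorb:
  assumes "subgroup K G" "a \<in> carrier G" "k \<in> K"
  shows "(a \<otimes> k) <# K = a <# K"
  using lcos_m_assoc[of K a k] coset_join3[of k K] subgroup.mem_carrier[OF assms(1)]
    subgroup.subset[OF assms(1)] assms by simp

lemma (in group) lcos_eq_iff:
  assumes K: "subgroup K G" and ab: "a \<in> carrier G" "b \<in> carrier G"
  shows "a <# K = b <# K \<longleftrightarrow> inv a \<otimes> b \<in> K"
proof
  assume "a <# K = b <# K"
  moreover have "b \<in> b <# K" by (rule lcos_self[OF ab(2) K])
  ultimately obtain k where "k \<in> K" "b = a \<otimes> k" by (auto simp: l_coset_def)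
  then show "inv a \<otimes> b \<in> K"
    using ab subgroup.mem_carrier[OF K] by (simp add: m_assoc[symmetric])
next
  assume *: "inv a \<otimes> b \<in> K"
  have "b = a \<otimes> (inv a \<otimes> b)" using ab by (simp add: m_assoc[symmetric])
  then show "a <# K = b <# K" using lcos_absorb[OF K ab(1) *] by simp
qed

text \<open>The extension map on labels is defined on sets, as \<open>C <#> K'\<close>. This
  identifies it with passing from \<sigma>K to \<sigma>K', so no choice of representative enters.
  The reason is K K' = K', since \<open>K\<close> contains the identity.\<close>

lemma (in group) lcos_set_mult_subgroup:
  assumes "subgroup K G" "subgroup K' G" "K \<subseteq> K'" "a \<in> carrier G"
  shows "(a <# K) <#> K' = a <# K'"
proof -
  have "K <#> K' = K'"
  proof
    show "K <#> K' \<subseteq> K'"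
      using subgroup.m_closed[OF assms(2)] assms(3) by (auto simp: set_mult_def)
    show "K' \<subseteq> K <#> K'"
    proof
      fix k assume "k \<in> K'"
      then have "k = \<one> \<otimes> k" using assms(2) subgroup.mem_carrier by fastforce
      then show "k \<in> K <#> K'"
        using subgroup.one_closed[OF assms(1)] \<open>k \<in> K'\<close> by (auto simp: set_mult_def)
    qed
  qed
  then show ?thesis
    using setmult_lcos_assoc[of K K' a] assms(4) assms(1,2)[THEN subgroup.subset] by simp
qed

text \<open>The right factor of \<open>k \<otimes> \<Delta> \<otimes> k'\<close> is absorbed by the
  coset, so the left factor alone parametrises the labels.\<close>

lemma (in group) hecke_cosets_eq:
  assumes K: "subgroup K G" and D: "\<Delta> \<in> carrier G"
  shows "hecke_cosets G K \<Delta> = (\<lambda>k. (k \<otimes> \<Delta>) <# K) ` K"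
proof -
  have c: "k \<in> carrier G" if "k \<in> K" for k using K that by (rule subgroup.mem_carrier)
  have "K <#> {\<Delta>} <#> K = {k \<otimes> \<Delta> \<otimes> k' |k k'. k \<in> K \<and> k' \<in> K}"
    by (auto simp: set_mult_def)
  then have "hecke_cosets G K \<Delta> = {(k \<otimes> \<Delta> \<otimes> k') <# K |k k'. k \<in> K \<and> k' \<in> K}"
    unfolding hecke_cosets_def by auto
  also have "\<dots> = {(k \<otimes> \<Delta>) <# K |k k'. k \<in> K \<and> k' \<in> K}"
    using lcos_absorb[OF K m_closed[OF c D]] by (auto; blast)
  finally show ?thesis using subgroup.one_closed[OF K] by auto
qed

text \<open>On \<open>A\<close> the map \<open>q \<circ> f\<close> equals the bijection
  \<open>g \<circ> p\<close>, and \<open>q\<close> can be cancelled. In the application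
  \<open>p\<close> and \<open>q\<close> pass to the component at x and \<open>g\<close> is the given
  local bijection.\<close>

lemma bij_betw_square:
  assumes "bij_betw p A A'" "bij_betw q B B'" "bij_betw g A' B'"
    and "f ` A \<subseteq> B" "\<And>a. a \<in> A \<Longrightarrow> q (f a) = g (p a)"
  shows "bij_betw f A B"
proof -
  have "bij_betw (g \<circ> p) A B'" using assms(1,3) by (rule bij_betw_trans)
  then have "bij_betw (q \<circ> f) A B'" using assms(5) by (subst bij_betw_cong[of _ _ "g \<circ> p"]) auto
  then show ?thesis using bij_betw_comp_iff2[OF assms(2,4)] by simp
qed

text \<open>The subgroup \<open>M\<close> collects the conditions away from the component that \<open>c\<close> projects to.\<close>

lemma hecke_cosets_projection:
  assumes A: "group A" and B: "group B" and c: "c \<in> hom A B"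
    and M: "subgroup M A" and L: "subgroup L B"
    and K: "subgroup K A" "K = {g \<in> M. c g \<in> L}" "c ` K = L" and D: "\<Delta> \<in> M"
  shows "bij_betw ((`) c) (hecke_cosets A K \<Delta>) (hecke_cosets B L (c \<Delta>))"
proof -
  interpret A: group A by fact
  interpret B: group B by fact
  interpret c: group_hom A B c by (simp add: group_hom_def group_hom_axioms_def A B c)
  interpret M: subgroup M A by fact
  have KM: "K \<subseteq> M" and DA: "\<Delta> \<in> carrier A" using K(2) D by auto
  have lc: "c ` (a <#\<^bsub>A\<^esub> K) = c a <#\<^bsub>B\<^esub> L" if "a \<in> carrier A" for a
  proof -
    have "c (a \<otimes>\<^bsub>A\<^esub> k) = c a \<otimes>\<^bsub>B\<^esub> c k" if "k \<in> K" for k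
      using c.hom_mult[OF \<open>a \<in> carrier A\<close>] that KM M.mem_carrier by blast
    then show ?thesis
      by (simp add: l_coset_def K(3)[symmetric] image_UN)
  qed
  have eq: "hecke_cosets A K \<Delta> = (\<lambda>k. (k \<otimes>\<^bsub>A\<^esub> \<Delta>) <#\<^bsub>A\<^esub> K) ` K"
    by (rule A.hecke_cosets_eq[OF K(1) DA])
  \<comment> \<open>Because \<open>c\<close> maps \<open>K\<close> onto \<open>L\<close>, the labels
    in \<open>B\<close> can be indexed by \<open>K\<close> as well; surjectivity is then immediate
    from \<open>im\<close>.\<close>
  have eqB: "hecke_cosets B L (c \<Delta>) = (\<lambda>k. (c k \<otimes>\<^bsub>B\<^esub> c \<Delta>) <#\<^bsub>B\<^esub> L) ` K"
    using B.hecke_cosets_eq[OF L c.hom_closed[OF DA]] by (simp add: K(3)[symmetric] image_image)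
  have im: "c ` ((k \<otimes>\<^bsub>A\<^esub> \<Delta>) <#\<^bsub>A\<^esub> K) = (c k \<otimes>\<^bsub>B\<^esub> c \<Delta>) <#\<^bsub>B\<^esub> L" if "k \<in> K" for k
  proof -
    have "k \<in> carrier A" using that KM M.mem_carrier by blast
    then show ?thesis using DA lc[of "k \<otimes>\<^bsub>A\<^esub> \<Delta>"] by simp
  qed
  show ?thesis
    unfolding bij_betw_def
  proof
    show "inj_on ((`) c) (hecke_cosets A K \<Delta>)"
    proof (rule inj_onI)
      fix C C' assume "C \<in> hecke_cosets A K \<Delta>" "C' \<in> hecke_cosets A K \<Delta>" and e: "c ` C = c ` C'"
      then obtain k k' where k: "k \<in> K" "k' \<in> K" and C: "C = (k \<otimes>\<^bsub>A\<^esub> \<Delta>) <#\<^bsub>A\<^esub> K" "C' = (k' \<otimes>\<^bsub>A\<^esub> \<Delta>) <#\<^bsub>A\<^esub> K"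
        unfolding eq by blast
      let ?g = "k \<otimes>\<^bsub>A\<^esub> \<Delta>" and ?g' = "k' \<otimes>\<^bsub>A\<^esub> \<Delta>"
      \<comment> \<open>Equal images only put c(g^-1 g') into \<open>L\<close>. Membership of g^-1
        g' in \<open>K\<close> also requires the conditions collected in \<open>M\<close>, and these
        hold because \<open>\<Delta>\<close> satisfies them.\<close>
      have g: "?g \<in> M" "?g' \<in> M" using k KM D by auto
      then have gA: "?g \<in> carrier A" "?g' \<in> carrier A" by auto
      have "c ?g <#\<^bsub>B\<^esub> L = c ?g' <#\<^bsub>B\<^esub> L" using e C lc gA by simp
      then have "inv\<^bsub>B\<^esub> (c ?g) \<otimes>\<^bsub>B\<^esub> c ?g' \<in> L"
        using B.lcos_eq_iff[OF L] gA c.hom_closed by blast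
      then have "c (inv\<^bsub>A\<^esub> ?g \<otimes>\<^bsub>A\<^esub> ?g') \<in> L" using gA by simp
      then have "inv\<^bsub>A\<^esub> ?g \<otimes>\<^bsub>A\<^esub> ?g' \<in> K" using g K(2) by simp
      then show "C = C'" using A.lcos_eq_iff[OF K(1)] gA C by blast
    qed
    show "(`) c ` hecke_cosets A K \<Delta> = hecke_cosets B L (c \<Delta>)"
      unfolding eq eqB using im by (simp add: image_image cong: image_cong)
  qed
qed

lemma hecke_cosets_extension:
  assumes A: "group A" and K: "subgroup K A" "subgroup K' A" "K \<subseteq> K'" and D: "\<Delta> \<in> carrier A"
  shows "(\<lambda>C. C <#>\<^bsub>A\<^esub> K') ` hecke_cosets A K \<Delta> \<subseteq> hecke_cosets A K' \<Delta>"
proof -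
  interpret A: group A by fact
  have "((k \<otimes>\<^bsub>A\<^esub> \<Delta>) <#\<^bsub>A\<^esub> K) <#>\<^bsub>A\<^esub> K' = (k \<otimes>\<^bsub>A\<^esub> \<Delta>) <#\<^bsub>A\<^esub> K'" if "k \<in> K" for k
    using that D by (intro A.lcos_set_mult_subgroup K) (auto dest: subgroup.mem_carrier[OF K(1)])
  then show ?thesis
    unfolding A.hecke_cosets_eq[OF K(1) D] A.hecke_cosets_eq[OF K(2) D] using K(3) by auto
qed

text \<open>The square has the extension maps in \<open>A\<close> and in \<open>B\<close> as
  horizontal sides and the projections along \<open>c\<close> as vertical sides; it commutes because
  \<open>c\<close> is multiplicative on sets. \<open>M\<close> and \<open>M'\<close> may differ, as
  the two levels can impose different conditions away from the chosen component.\<close>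

lemma hecke_cosets_local_global:
  assumes A: "group A" and B: "group B" and c: "c \<in> hom A B" and D: "\<Delta> \<in> M" "\<Delta> \<in> M'"
    and M: "subgroup M A" and L: "subgroup L B"
    and K: "subgroup K A" "K = {g \<in> M. c g \<in> L}" "c ` K = L"
    and M': "subgroup M' A" and L': "subgroup L' B"
    and K': "subgroup K' A" "K' = {g \<in> M'. c g \<in> L'}" "c ` K' = L'"
    and le: "K \<subseteq> K'"
    and loc: "bij_betw (\<lambda>C. C <#>\<^bsub>B\<^esub> L') (hecke_cosets B L (c \<Delta>)) (hecke_cosets B L' (c \<Delta>))"
  shows "bij_betw (\<lambda>C. C <#>\<^bsub>A\<^esub> K') (hecke_cosets A K \<Delta>) (hecke_cosets A K' \<Delta>)"
proof (rule bij_betw_square[OF hecke_cosets_projection[OF A B c M L K D(1)]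
      hecke_cosets_projection[OF A B c M' L' K' D(2)] loc])
  interpret A: group A by fact
  interpret B: group B by fact
  interpret c: group_hom A B c by (simp add: group_hom_def group_hom_axioms_def A B c)
  have DA: "\<Delta> \<in> carrier A" using subgroup.mem_carrier[OF M D(1)] .
  show "(\<lambda>C. C <#>\<^bsub>A\<^esub> K') ` hecke_cosets A K \<Delta> \<subseteq> hecke_cosets A K' \<Delta>"
    by (rule hecke_cosets_extension[OF A K(1) K'(1) le DA])
  fix C assume "C \<in> hecke_cosets A K \<Delta>"
  then have "C \<subseteq> carrier A"
    unfolding A.hecke_cosets_eq[OF K(1) DA] using DA subgroup.mem_carrier[OF K(1)]
    by (auto simp: l_coset_def)
  then show "c ` (C <#>\<^bsub>A\<^esub> K') = c ` C <#>\<^bsub>B\<^esub> L'"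
    using c.homh set_mult_hom[of c A B C K'] subgroup.subset[OF K'(1)] K'(3) by simp
qed

section \<open>Change of representative and edges over a fixed target\<close>

lemma (in group) lcos_bij_hecke_cosets:
  assumes K: "subgroup K G" and D: "\<Delta> \<in> carrier G" and k: "\<kappa> \<in> K"
  shows "bij_betw (\<lambda>C. \<kappa> <# C) (hecke_cosets G K \<Delta>) (hecke_cosets G K \<Delta>)"
proof -
  have sub: "C \<subseteq> carrier G" if "C \<in> hecke_cosets G K \<Delta>" for C
    using that D subgroup.mem_carrier[OF K] unfolding hecke_cosets_eq[OF K D]
    by (auto simp: l_coset_def)
  have into: "\<kappa> <# C \<in> hecke_cosets G K \<Delta>" if C: "C \<in> hecke_cosets G K \<Delta>" and a: "\<kappa> \<in> K" for C \<kappa>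
  proof -
    obtain k where "k \<in> K" "C = (k \<otimes> \<Delta>) <# K"
      using C unfolding hecke_cosets_eq[OF K D] by blast
    then have "\<kappa> <# C = (\<kappa> \<otimes> k \<otimes> \<Delta>) <# K"
      using lcos_m_assoc[of K \<kappa> "k \<otimes> \<Delta>"] subgroup.subset[OF K] subgroup.mem_carrier[OF K] D a
      by (simp add: m_assoc)
    then show ?thesis
      unfolding hecke_cosets_eq[OF K D] using subgroup.m_closed[OF K a \<open>k \<in> K\<close>] by blast
  qed
  have canc: "inv a <# (a <# C) = C" if "C \<in> hecke_cosets G K \<Delta>" "a \<in> carrier G" for a C
    using lcos_m_assoc[OF sub[OF that(1)], of "inv a" a] that(2) sub[OF that(1)]
    by (simp add: lcos_mult_one)
  have kc: "\<kappa> \<in> carrier G" "inv \<kappa> \<in> K"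
    using subgroup.mem_carrier[OF K k] subgroup.m_inv_closed[OF K k] by auto
  show ?thesis
    by (rule bij_betw_byWitness[where f' = "\<lambda>C. inv \<kappa> <# C"])
      (use canc[of _ \<kappa>] canc[of _ "inv \<kappa>"] into k kc in auto)
qed

lemma bij_betw_Collect:
  assumes "bij_betw f A B" "\<And>a. a \<in> A \<Longrightarrow> P a \<longleftrightarrow> Q (f a)"
  shows "bij_betw f {a \<in> A. P a} {b \<in> B. Q b}"
  using assms unfolding bij_betw_def inj_on_def by auto

lemma (in group) subgroup_absorb_left:
  assumes Q: "subgroup Q G" and "\<gamma> \<in> Q" "Z \<subseteq> carrier G"
  shows "Q <#> (\<gamma> <# Z) = Q <#> Z"
proof -
  note c = subgroup.subset[OF Q] subgroup.mem_carrier[OF Q assms(2)]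
  have "Q <#> (\<gamma> <# Z) = (Q #> \<gamma>) <#> Z"
    using c set_mult_assoc[of Q "{\<gamma>}" Z] assms(3)
    by (simp add: l_coset_eq_set_mult r_coset_eq_set_mult)
  then show ?thesis using coset_join2[OF c(2) Q assms(2)] by simp
qed

text \<open>Applied to a vertex, this shows that \<open>vertex_map\<close>, an operation on sets,
  sends the class of \<open>g\<close> at the finer level to its class at the coarser one.\<close>

lemma (in group) double_coset_extension:
  assumes K: "subgroup K G" "subgroup K' G" "K \<subseteq> K'" and "Q \<subseteq> carrier G" "g \<in> carrier G"
  shows "Q <#> {g} <#> K <#> K' = Q <#> {g} <#> K'"
proof -
  have "K <#> K' = K'"
    using lcos_set_mult_subgroup[OF K one_closed] subgroup.subset[OF K(1)] subgroup.subset[OF K(2)]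
    by (simp add: lcos_mult_one)
  moreover have "Q <#> {g} \<subseteq> carrier G" using assms(4,5) by (intro set_mult_closed) auto
  ultimately show ?thesis
    using set_mult_assoc[of "Q <#> {g}" K K'] subgroup.subset[OF K(1)] subgroup.subset[OF K(2)] by simp
qed

text \<open>Expressing both elements through \<open>g\<close> and eliminating \<open>g\<close>
  leaves q q'^-1 on the left and k'^-1 k on the right. This supplies the pair \<gamma>, \<kappa>
  that compares the representatives chosen in the two graphs.\<close>

lemma (in group) double_coset_transport:
  assumes Q: "subgroup Q G" and K: "subgroup K G" and g: "g \<in> carrier G"
    and r: "r \<in> Q <#> {g} <#> K" "r' \<in> Q <#> {g} <#> K"
  obtains \<gamma> \<kappa> where "\<gamma> \<in> Q" "\<kappa> \<in> K" "r = \<gamma> \<otimes> r' \<otimes> \<kappa>"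
proof -
  note c = subgroup.mem_carrier[OF Q] subgroup.mem_carrier[OF K]
  obtain q k q' k' where q: "q \<in> Q" "k \<in> K" "r = q \<otimes> g \<otimes> k" "q' \<in> Q" "k' \<in> K" "r' = q' \<otimes> g \<otimes> k'"
    using r by (auto simp: set_mult_def)
  have "r = (q \<otimes> inv q') \<otimes> r' \<otimes> (inv k' \<otimes> k)"
  proof -
    have "(q \<otimes> inv q') \<otimes> r' \<otimes> (inv k' \<otimes> k) = q \<otimes> (inv q' \<otimes> q') \<otimes> g \<otimes> (k' \<otimes> inv k') \<otimes> k"
      using q c g by (simp only: m_assoc m_closed inv_closed)
    also have "\<dots> = r" using q c g by simp
    finally show ?thesis by simp
  qed
  moreover have "q \<otimes> inv q' \<in> Q" "inv k' \<otimes> k \<in> K"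
    using q Q K by (auto intro: subgroup.m_closed subgroup.m_inv_closed)
  ultimately show thesis using that by blast
qed

text \<open>Left translation by \<open>\<kappa>\<close> permutes the cosets, and moves \<open>r \<sigma>\<close> to \<open>r' \<kappa> \<sigma>\<close> up to \<open>\<gamma>\<close>.\<close>

lemma (in group) hecke_edges_bij:
  assumes Q: "subgroup Q G" and K: "subgroup K G" "subgroup K' G" "K \<subseteq> K'" and D: "\<Delta> \<in> carrier G"
    and bij: "bij_betw (\<lambda>C. C <#> K') (hecke_cosets G K \<Delta>) (hecke_cosets G K' \<Delta>)"
    and r: "r' \<in> carrier G" "\<gamma> \<in> Q" "\<kappa> \<in> K'" "r = \<gamma> \<otimes> r' \<otimes> \<kappa>"
  shows "bij_betw (\<lambda>C. \<kappa> <# (C <#> K'))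
    {C \<in> hecke_cosets G K \<Delta>. Q <#> (r <# C) <#> K' = b} {C \<in> hecke_cosets G K' \<Delta>. Q <#> (r' <# C) = b}"
proof (rule bij_betw_Collect)
  show "bij_betw (\<lambda>C. \<kappa> <# (C <#> K')) (hecke_cosets G K \<Delta>) (hecke_cosets G K' \<Delta>)"
    using bij_betw_trans[OF bij lcos_bij_hecke_cosets[OF K(2) D r(3)]] by (simp add: o_def)
  fix C assume "C \<in> hecke_cosets G K \<Delta>"
  then have C: "C \<subseteq> carrier G"
    using D subgroup.mem_carrier[OF K(1)] unfolding hecke_cosets_eq[OF K(1) D]
    by (auto simp: l_coset_def)
  have c: "\<gamma> \<in> carrier G" "\<kappa> \<in> carrier G" "K' \<subseteq> carrier G" "Q \<subseteq> carrier G"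
    using subgroup.mem_carrier[OF Q r(2)] subgroup.mem_carrier[OF K(2) r(3)]
      subgroup.subset[OF Q] subgroup.subset[OF K(2)] by auto
  have CK: "C <#> K' \<subseteq> carrier G" using C c by (intro set_mult_closed)
  then have Z: "r' <# (\<kappa> <# (C <#> K')) \<subseteq> carrier G"
    using r(1) c by (intro l_coset_subset_G) auto
  have rc: "r \<in> carrier G" using r(1,4) c by simp
  \<comment> \<open>The left side is the image of the head of the edge labelled \<open>C\<close>.
    Regroup, substitute \<open>r = \<gamma> \<otimes> r' \<otimes> \<kappa>\<close>, and let
    \<open>Q\<close> absorb \<gamma>; what remains is the head of the edge labelled \<kappa>CK' out
    of \<open>r'\<close>.\<close>
  have "Q <#> (r <# C) <#> K' = Q <#> (r <# (C <#> K'))"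
    using set_mult_assoc[of Q "r <# C" K'] setmult_lcos_assoc[of C K' r] C c rc l_coset_subset_G[OF C rc]
    by simp
  also have "r <# (C <#> K') = \<gamma> <# (r' <# (\<kappa> <# (C <#> K')))"
    using CK c r(1) l_coset_subset_G[OF CK c(2)] by (simp add: r(4) lcos_m_assoc m_assoc)
  also have "Q <#> \<dots> = Q <#> (r' <# (\<kappa> <# (C <#> K')))"
    using Q r(2) Z by (rule subgroup_absorb_left)
  finally show "Q <#> (r <# C) <#> K' = b \<longleftrightarrow> Q <#> (r' <# (\<kappa> <# (C <#> K'))) = b" by simp
qed

section \<open>General linear groups and base change\<close>

lemma (in abelian_monoid) finsum_swap:
  assumes "finite I" "finite J" "\<And>i j. i \<in> I \<Longrightarrow> j \<in> J \<Longrightarrow> f i j \<in> carrier G"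
  shows "(\<Oplus>i\<in>I. \<Oplus>j\<in>J. f i j) = (\<Oplus>j\<in>J. \<Oplus>i\<in>I. f i j)"
  using assms(1,3)
proof (induction I)
  case empty
  then show ?case by simp
next
  case (insert a I)
  have 1: "f a \<in> J \<rightarrow> carrier G" "(\<lambda>j. \<Oplus>i\<in>I. f i j) \<in> J \<rightarrow> carrier G"
    using insert.prems by (auto intro!: finsum_closed)
  have 2: "(\<lambda>i. \<Oplus>j\<in>J. f i j) \<in> I \<rightarrow> carrier G" "(\<Oplus>j\<in>J. f a j) \<in> carrier G"
    using insert.prems by (auto intro!: finsum_closed)
  have "(\<Oplus>i\<in>insert a I. \<Oplus>j\<in>J. f i j) = (\<Oplus>j\<in>J. f a j) \<oplus> (\<Oplus>i\<in>I. \<Oplus>j\<in>J. f i j)"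
    using insert.hyps 2 by (rule finsum_insert)
  also have "\<dots> = (\<Oplus>j\<in>J. f a j) \<oplus> (\<Oplus>j\<in>J. \<Oplus>i\<in>I. f i j)"
    using insert by simp
  also have "\<dots> = (\<Oplus>j\<in>J. f a j \<oplus> (\<Oplus>i\<in>I. f i j))"
    using finsum_addf[OF 1] by simp
  also have "\<dots> = (\<Oplus>j\<in>J. \<Oplus>i\<in>insert a I. f i j)"
    using insert.hyps insert.prems 1 by (intro finsum_cong') (auto simp: finsum_insert Pi_def)
  finally show ?case .
qed

lemma Mat_mult:
  "i < n \<Longrightarrow> j < n \<Longrightarrow> (A \<otimes>\<^bsub>Mat n R\<^esub> B) (i, j) = (\<Oplus>\<^bsub>R\<^esub>l\<in>{..<n}. A (i, l) \<otimes>\<^bsub>R\<^esub> B (l, j))"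
  by (simp add: Mat_def)

lemma Mat_one:
  "i < n \<Longrightarrow> j < n \<Longrightarrow> \<one>\<^bsub>Mat n R\<^esub> (i, j) = (if i = j then \<one>\<^bsub>R\<^esub> else \<zero>\<^bsub>R\<^esub>)"
  by (simp add: Mat_def)

lemma Mat_carrier: "carrier (Mat n R) = idx n \<rightarrow>\<^sub>E carrier R"
  by (simp add: Mat_def)

lemma Mat_entry: "A \<in> carrier (Mat n R) \<Longrightarrow> i < n \<Longrightarrow> j < n \<Longrightarrow> A (i, j) \<in> carrier R"
  by (auto simp: Mat_carrier)

lemma Mat_mult_extensional: "A \<otimes>\<^bsub>Mat n R\<^esub> B \<in> extensional (idx n)"
  by (simp add: Mat_def)

lemma Mat_one_extensional: "\<one>\<^bsub>Mat n R\<^esub> \<in> extensional (idx n)"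
  by (simp add: Mat_def)

lemma Mat_extensional: "A \<in> carrier (Mat n R) \<Longrightarrow> A \<in> extensional (idx n)"
  by (simp add: Mat_carrier PiE_def)

lemma idx_eqI:
  assumes "A \<in> extensional (idx n)" "B \<in> extensional (idx n)"
    and "\<And>i j. i < n \<Longrightarrow> j < n \<Longrightarrow> A (i, j) = B (i, j)"
  shows "A = B"
  using assms by (intro extensionalityI[of A "idx n"]) auto

lemma Mat_memI:
  assumes "A \<in> extensional (idx n)" "\<And>i j. i < n \<Longrightarrow> j < n \<Longrightarrow> A (i, j) \<in> carrier R"
  shows "A \<in> carrier (Mat n R)"
  using assms by (auto simp: Mat_carrier PiE_def)

lemma (in cring) Mat_mult_closed:
  assumes "A \<in> carrier (Mat n R)" "B \<in> carrier (Mat n R)"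
  shows "A \<otimes>\<^bsub>Mat n R\<^esub> B \<in> carrier (Mat n R)"
  using Mat_entry[OF assms(1)] Mat_entry[OF assms(2)]
  by (auto simp: Mat_mult intro!: Mat_memI Mat_mult_extensional finsum_closed)

lemma (in cring) Mat_assoc:
  assumes A: "A \<in> carrier (Mat n R)" and B: "B \<in> carrier (Mat n R)" and C: "C \<in> carrier (Mat n R)"
  shows "A \<otimes>\<^bsub>Mat n R\<^esub> B \<otimes>\<^bsub>Mat n R\<^esub> C = A \<otimes>\<^bsub>Mat n R\<^esub> (B \<otimes>\<^bsub>Mat n R\<^esub> C)"
proof (rule idx_eqI[OF Mat_mult_extensional Mat_mult_extensional])
  fix i j assume ij: "i < n" "j < n"
  note e = Mat_entry[OF A] Mat_entry[OF B] Mat_entry[OF C]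
  have "(A \<otimes>\<^bsub>Mat n R\<^esub> B \<otimes>\<^bsub>Mat n R\<^esub> C) (i, j)
      = (\<Oplus>l\<in>{..<n}. (\<Oplus>m\<in>{..<n}. A (i, m) \<otimes> B (m, l)) \<otimes> C (l, j))"
    using ij e Mat_mult_closed[OF A B, THEN Mat_entry]
    by (auto simp: Mat_mult intro!: finsum_cong')
  also have "\<dots> = (\<Oplus>l\<in>{..<n}. \<Oplus>m\<in>{..<n}. A (i, m) \<otimes> (B (m, l) \<otimes> C (l, j)))"
    using ij e by (auto simp: finsum_ldistr m_assoc intro!: finsum_cong' finsum_closed)
  also have "\<dots> = (\<Oplus>m\<in>{..<n}. \<Oplus>l\<in>{..<n}. A (i, m) \<otimes> (B (m, l) \<otimes> C (l, j)))"
    using ij e by (intro finsum_swap) auto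
  also have "\<dots> = (\<Oplus>m\<in>{..<n}. A (i, m) \<otimes> (\<Oplus>l\<in>{..<n}. B (m, l) \<otimes> C (l, j)))"
    using ij e by (auto simp: finsum_rdistr intro!: finsum_cong' finsum_closed)
  also have "\<dots> = (A \<otimes>\<^bsub>Mat n R\<^esub> (B \<otimes>\<^bsub>Mat n R\<^esub> C)) (i, j)"
    using ij e Mat_mult_closed[OF B C, THEN Mat_entry]
    by (auto simp: Mat_mult intro!: finsum_cong' finsum_closed)
  finally show "(A \<otimes>\<^bsub>Mat n R\<^esub> B \<otimes>\<^bsub>Mat n R\<^esub> C) (i, j) = (A \<otimes>\<^bsub>Mat n R\<^esub> (B \<otimes>\<^bsub>Mat n R\<^esub> C)) (i, j)" .
qed

lemma (in cring) Mat_monoid: "monoid (Mat n R)"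
proof
  have one: "\<one>\<^bsub>Mat n R\<^esub> \<in> carrier (Mat n R)"
    by (intro Mat_memI Mat_one_extensional) (auto simp: Mat_one)
  then show "\<one>\<^bsub>Mat n R\<^esub> \<in> carrier (Mat n R)" .
  fix A assume A: "A \<in> carrier (Mat n R)"
  note e = Mat_entry[OF A]
  show "\<one>\<^bsub>Mat n R\<^esub> \<otimes>\<^bsub>Mat n R\<^esub> A = A"
  proof (rule idx_eqI[OF Mat_mult_extensional Mat_extensional[OF A]])
    fix i j assume ij: "i < n" "j < n"
    have "(\<Oplus>l\<in>{..<n}. \<one>\<^bsub>Mat n R\<^esub> (i, l) \<otimes> A (l, j)) = (\<Oplus>l\<in>{..<n}. if i = l then A (l, j) else \<zero>)"
      using ij e by (intro finsum_cong') (auto simp: Mat_one)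
    also have "\<dots> = A (i, j)" using ij e by (intro finsum_singleton) auto
    finally show "(\<one>\<^bsub>Mat n R\<^esub> \<otimes>\<^bsub>Mat n R\<^esub> A) (i, j) = A (i, j)" using ij by (simp add: Mat_mult)
  qed
  show "A \<otimes>\<^bsub>Mat n R\<^esub> \<one>\<^bsub>Mat n R\<^esub> = A"
  proof (rule idx_eqI[OF Mat_mult_extensional Mat_extensional[OF A]])
    fix i j assume ij: "i < n" "j < n"
    have "(\<Oplus>l\<in>{..<n}. A (i, l) \<otimes> \<one>\<^bsub>Mat n R\<^esub> (l, j)) = (\<Oplus>l\<in>{..<n}. if j = l then A (i, l) else \<zero>)"
      using ij e by (intro finsum_cong') (auto simp: Mat_one)
    also have "\<dots> = A (i, j)" using ij e by (intro finsum_singleton) auto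
    finally show "(A \<otimes>\<^bsub>Mat n R\<^esub> \<one>\<^bsub>Mat n R\<^esub>) (i, j) = A (i, j)" using ij by (simp add: Mat_mult)
  qed
qed (auto simp: Mat_mult_closed Mat_assoc)

lemma GL_carrier: "carrier (GL n R) = Units (Mat n R)"
  and GL_mult: "A \<otimes>\<^bsub>GL n R\<^esub> B = A \<otimes>\<^bsub>Mat n R\<^esub> B"
  and GL_one: "\<one>\<^bsub>GL n R\<^esub> = \<one>\<^bsub>Mat n R\<^esub>"
  by (simp_all add: GL_def units_of_carrier units_of_mult units_of_one)

lemma (in cring) GL_group: "group (GL n R)"
  unfolding GL_def by (rule monoid.units_group[OF Mat_monoid])

lemma GL_Mat: "g \<in> carrier (GL n R) \<Longrightarrow> g \<in> carrier (Mat n R)"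
  by (simp add: GL_carrier Units_def)

lemmas GL_extensional = Mat_extensional[OF GL_Mat]

lemma (in cring) GL_memI:
  assumes "A \<in> carrier (Mat n R)" "B \<in> carrier (Mat n R)"
    and "A \<otimes>\<^bsub>Mat n R\<^esub> B = \<one>\<^bsub>Mat n R\<^esub>" "B \<otimes>\<^bsub>Mat n R\<^esub> A = \<one>\<^bsub>Mat n R\<^esub>"
  shows "A \<in> carrier (GL n R)" "inv\<^bsub>GL n R\<^esub> A = B"
proof -
  interpret group "GL n R" by (rule GL_group)
  show A: "A \<in> carrier (GL n R)" using assms by (auto simp: GL_carrier Units_def)
  have "B \<in> carrier (GL n R)" using assms by (auto simp: GL_carrier Units_def)
  then show "inv\<^bsub>GL n R\<^esub> A = B" using A assms(4) inv_equality by (simp add: GL_mult GL_one)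
qed

lemma mat_map_apply: "i < n \<Longrightarrow> j < n \<Longrightarrow> mat_map n h A (i, j) = h (A (i, j))"
  by (simp add: mat_map_def)

lemma mat_map_extensional: "mat_map n h A \<in> extensional (idx n)"
  by (simp add: mat_map_def)

lemma mat_map_id: "A \<in> extensional (idx n) \<Longrightarrow> mat_map n (\<lambda>a. a) A = A"
  by (rule idx_eqI[OF mat_map_extensional]) (auto simp: mat_map_apply)

context ring_hom_cring
begin

lemma mat_map_closed: "A \<in> carrier (Mat n R) \<Longrightarrow> mat_map n h A \<in> carrier (Mat n S)"
  by (intro Mat_memI mat_map_extensional) (auto simp: mat_map_apply Mat_entry)

lemma mat_map_mult:
  assumes "A \<in> carrier (Mat n R)" "B \<in> carrier (Mat n R)"
  shows "mat_map n h (A \<otimes>\<^bsub>Mat n R\<^esub> B) = mat_map n h A \<otimes>\<^bsub>Mat n S\<^esub> mat_map n h B"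
  using Mat_entry[OF assms(1)] Mat_entry[OF assms(2)]
  by (intro idx_eqI[OF mat_map_extensional Mat_mult_extensional])
    (auto simp: mat_map_apply Mat_mult Pi_def o_def intro!: S.finsum_cong')

lemma mat_map_one: "mat_map n h \<one>\<^bsub>Mat n R\<^esub> = \<one>\<^bsub>Mat n S\<^esub>"
  by (rule idx_eqI[OF mat_map_extensional Mat_one_extensional]) (auto simp: mat_map_apply Mat_one)

lemma mat_map_GL: "mat_map n h \<in> hom (GL n R) (GL n S)"
proof (rule homI)
  fix g assume "g \<in> carrier (GL n R)"
  then obtain g' where g: "g \<in> carrier (Mat n R)" "g' \<in> carrier (Mat n R)"
    "g \<otimes>\<^bsub>Mat n R\<^esub> g' = \<one>\<^bsub>Mat n R\<^esub>" "g' \<otimes>\<^bsub>Mat n R\<^esub> g = \<one>\<^bsub>Mat n R\<^esub>"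
    by (auto simp: GL_carrier Units_def)
  show "mat_map n h g \<in> carrier (GL n S)"
    by (rule S.GL_memI[OF mat_map_closed[OF g(1)] mat_map_closed[OF g(2)]])
      (simp_all add: g mat_map_mult[symmetric] mat_map_one)
qed (simp add: GL_mult GL_Mat mat_map_mult)

lemma mat_map_group_hom: "group_hom (GL n R) (GL n S) (mat_map n h)"
  by (simp add: group_hom_def group_hom_axioms_def R.GL_group S.GL_group mat_map_GL)

lemma hom_nat_pow: "a \<in> carrier R \<Longrightarrow> h (a [^] (k::nat)) = h a [^]\<^bsub>S\<^esub> k"
  by (induction k) auto

end

section \<open>Regular functions and points under change of ring\<close>

lemma (in cring) coords_closed:
  assumes "g \<in> carrier (GL n R)" "v \<in> idx n <+> idx n"
  shows "coords n R g v \<in> carrier R"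
  using assms group.inv_closed[OF GL_group assms(1)]
  by (auto simp: coords_def intro!: Mat_entry GL_Mat)

lemma (in cring) fun_eval_closed:
  assumes "g \<in> carrier (GL n R)" "f \<in> regular_funs n" "\<And>c. \<phi> c \<in> carrier R"
  shows "fun_eval n R \<phi> f g \<in> carrier R"
  using assms(2) coords_closed[OF assms(1)] unfolding fun_eval_def pol_eval_def regular_funs_def pol_vars_def
  by (intro finsum_closed Pi_I m_closed finprod_closed nat_pow_closed assms(3)) blast

text \<open>The \<open>Inr\<close> coordinates are entries of the inverse, so they are compatible
  with \<open>h\<close> because \<open>mat_map\<close> is a group homomorphism on GL.\<close>

lemma (in ring_hom_cring) hom_coords:
  assumes "g \<in> carrier (GL n R)" "v \<in> idx n <+> idx n"
  shows "h (coords n R g v) = coords n S (mat_map n h g) v"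
  using assms(2)
  by (auto simp: coords_def mat_map_apply group_hom.hom_inv[OF mat_map_group_hom assms(1), symmetric])

lemma (in ring_hom_cring) hom_fun_eval:
  assumes g: "g \<in> carrier (GL n R)" and f: "f \<in> regular_funs n" and \<phi>: "\<And>c. \<phi> c \<in> carrier R"
  shows "h (fun_eval n R \<phi> f g) = fun_eval n S (\<lambda>c. h (\<phi> c)) f (mat_map n h g)"
proof -
  \<comment> \<open>Regularity confines the variables of \<open>f\<close> to valid indices; at other
    indices the coordinates are unspecified values that need not lie in the carrier.\<close>
  have v: "v \<in> idx n <+> idx n"
    if "m \<in> Poly_Mapping.keys f" "v \<in> Poly_Mapping.keys m" for m v
    using f that unfolding regular_funs_def pol_vars_def by blast
  let ?R = "coords n R g" and ?S = "coords n S (mat_map n h g)"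
  have cS: "?S v \<in> carrier S" if "v \<in> idx n <+> idx n" for v
    using that g by (metis R.coords_closed hom_closed hom_coords)
  have p: "(\<Otimes>v\<in>Poly_Mapping.keys m. ?R v [^] Poly_Mapping.lookup m v) \<in> carrier R"
    if "m \<in> Poly_Mapping.keys f" for m
    using v[OF that] R.coords_closed[OF g] by (auto intro!: R.finprod_closed)
  have hp: "h (\<Otimes>v\<in>Poly_Mapping.keys m. ?R v [^] Poly_Mapping.lookup m v)
      = (\<Otimes>\<^bsub>S\<^esub>v\<in>Poly_Mapping.keys m. ?S v [^]\<^bsub>S\<^esub> Poly_Mapping.lookup m v)"
    if "m \<in> Poly_Mapping.keys f" for m
    using v[OF that] R.coords_closed[OF g] hom_coords[OF g] cS
    by (subst hom_finprod) (auto simp: hom_nat_pow intro!: S.finprod_cong')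
  show ?thesis
    unfolding fun_eval_def pol_eval_def
    using p hp hom_closed[OF \<phi>] hom_closed[OF p, unfolded hp] \<phi>
    by (subst hom_finsum) (auto intro!: S.finsum_cong')
qed

lemma (in ring_hom_cring) mat_map_pts:
  assumes "\<And>c. \<phi> c \<in> carrier R" "E \<subseteq> regular_funs n" "g \<in> pts n E R \<phi>"
  shows "mat_map n h g \<in> pts n E S (\<lambda>c. h (\<phi> c))"
proof -
  have g: "g \<in> carrier (GL n R)" using assms(3) by (simp add: pts_def)
  have "fun_eval n S (\<lambda>c. h (\<phi> c)) f (mat_map n h g) = \<zero>\<^bsub>S\<^esub>" if "f \<in> E" for f
    using hom_fun_eval[of g n f \<phi>] g that assms by (auto simp: pts_def)
  then show ?thesis
    using hom_in_carrier[OF mat_map_GL g] by (simp add: pts_def)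
qed

text \<open>An injective homomorphism reflects the vanishing of each equation. This is how points
  descend to a subalgebra.\<close>

lemma (in ring_hom_cring) mat_map_pts_iff:
  assumes "\<And>c. \<phi> c \<in> carrier R" "E \<subseteq> regular_funs n" "g \<in> carrier (GL n R)" "inj_on h (carrier R)"
  shows "mat_map n h g \<in> pts n E S (\<lambda>c. h (\<phi> c)) \<longleftrightarrow> g \<in> pts n E R \<phi>"
proof
  assume *: "mat_map n h g \<in> pts n E S (\<lambda>c. h (\<phi> c))"
  have "fun_eval n R \<phi> f g = \<zero>" if "f \<in> E" for f
  proof -
    have "h (fun_eval n R \<phi> f g) = h \<zero>"
      using hom_fun_eval[of g n f \<phi>] that assms(1-3) * by (auto simp: pts_def)
    moreover have "fun_eval n R \<phi> f g \<in> carrier R"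
      using that assms(2) by (intro R.fun_eval_closed assms) auto
    ultimately show ?thesis using inj_onD[OF assms(4)] by blast
  qed
  then show "g \<in> pts n E R \<phi>" using assms(3) by (simp add: pts_def)
qed (rule mat_map_pts[OF assms(1,2)])

section \<open>Reduction to countable algebras\<close>

lemma (in cring) ring_hom_cring_incl:
  assumes "subring C R"
  shows "ring_hom_cring (R\<lparr>carrier := C\<rparr>) R (\<lambda>a. a)"
proof -
  have "cring (R\<lparr>carrier := C\<rparr>)"
    using subcring_iff[OF subringE(1)[OF assms]] subcringI'[OF assms] by simp
  then show ?thesis
    using subringE(1)[OF assms]
    by (auto simp: ring_hom_cring_def ring_hom_cring_axioms_def ring_hom_def is_cring)
qed

text \<open>The generated ring is exhausted by countably many stages, each adding the unit, the
  generators and the results of one ring operation on the previous stage.\<close>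

lemma countable_generate_ring:
  assumes "countable E"
  shows "countable (generate_ring R E)"
proof -
  define F where "F A = insert \<one>\<^bsub>R\<^esub> (E \<union> (\<Union>a\<in>A. \<Union>b\<in>A. {\<ominus>\<^bsub>R\<^esub> a, a \<oplus>\<^bsub>R\<^esub> b, a \<otimes>\<^bsub>R\<^esub> b}))" for A
  have FI: "\<one>\<^bsub>R\<^esub> \<in> F A" "a \<in> E \<Longrightarrow> a \<in> F A" "a \<in> A \<Longrightarrow> \<ominus>\<^bsub>R\<^esub> a \<in> F A"
    "a \<in> A \<Longrightarrow> b \<in> A \<Longrightarrow> a \<oplus>\<^bsub>R\<^esub> b \<in> F A" "a \<in> A \<Longrightarrow> b \<in> A \<Longrightarrow> a \<otimes>\<^bsub>R\<^esub> b \<in> F A" for A a b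
    unfolding F_def by blast+
  have F: "mono F" unfolding F_def by (rule monoI) blast
  have c: "countable ((F ^^ k) {})" for k
    by (induction k) (simp_all add: F_def assms countable_UN)
  \<comment> \<open>\<open>F A\<close> need not contain \<open>A\<close>; the stages still increase
    because \<open>F\<close> is monotone and the iteration starts at the empty set. Hence two
    elements always share a stage.\<close>
  have mono: "(F ^^ k) {} \<subseteq> (F ^^ l) {}" if "k \<le> l" for k l
    using funpow_decreasing[OF that F] .
  have "\<exists>k. x \<in> (F ^^ k) {}" if "x \<in> generate_ring R E" for x
    using that
  proof (induction rule: generate_ring.induct)
    case one
    then show ?case by (intro exI[of _ 1]) (simp add: FI)
  next
    case (incl x)
    then show ?case by (intro exI[of _ 1]) (simp add: FI)
  next
    case (a_inv x)
    then obtain k where "x \<in> (F ^^ k) {}" by blast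
    then show ?case by (intro exI[of _ "Suc k"]) (simp add: FI)
  next
    case (eng_add x y)
    then obtain k l where "x \<in> (F ^^ k) {}" "y \<in> (F ^^ l) {}" by blast
    then have "x \<in> (F ^^ max k l) {}" "y \<in> (F ^^ max k l) {}"
      using mono[of k "max k l"] mono[of l "max k l"] by auto
    then show ?case by (intro exI[of _ "Suc (max k l)"]) (simp add: FI)
  next
    case (eng_mult x y)
    then obtain k l where "x \<in> (F ^^ k) {}" "y \<in> (F ^^ l) {}" by blast
    then have "x \<in> (F ^^ max k l) {}" "y \<in> (F ^^ max k l) {}"
      using mono[of k "max k l"] mono[of l "max k l"] by auto
    then show ?case by (intro exI[of _ "Suc (max k l)"]) (simp add: FI)
  qed
  then have "generate_ring R E \<subseteq> (\<Union>k. (F ^^ k) {})" by blast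
  then show ?thesis by (rule countable_subset) (intro countable_UN countableI_type c)
qed

text \<open>The subring generated by \<open>E\<close> and the image of \<open>k\<close> is
  countable; its structure is transported along an injection into \<open>nat\<close>. The image of
  \<open>k\<close> is adjoined so that \<phi> factors through the subring.\<close>

lemma k_algebra_countable_model:
  fixes \<phi> :: "'k::{field,countable} \<Rightarrow> 'r"
  assumes "k_algebra R \<phi>" "countable E" "E \<subseteq> carrier R"
  obtains R\<^sub>0 :: "nat ring" and \<phi>\<^sub>0 h where
    "k_algebra R\<^sub>0 \<phi>\<^sub>0" "ring_hom_cring R\<^sub>0 R h" "inj_on h (carrier R\<^sub>0)"
    "(\<lambda>c. h (\<phi>\<^sub>0 c)) = \<phi>" "E \<subseteq> h ` carrier R\<^sub>0"
proof -
  interpret R: cring R using assms(1) by (simp add: k_algebra_def)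
  have \<phi>: "\<phi> \<in> ring_hom type_ring R" using assms(1) by (simp add: k_algebra_def)
  have \<phi>c: "\<phi> c \<in> carrier R" for c
    using ring_hom_closed[OF \<phi>] by (simp add: ring_of_type_algebra_def)
  define C where "C = generate_ring R (E \<union> range \<phi>)"
  let ?R = "R\<lparr>carrier := C\<rparr>"
  define f where "f = to_nat_on C"
  define R\<^sub>0 where "R\<^sub>0 = image_ring f ?R"
  define h where "h = inv_into C f"
  have "E \<union> range \<phi> \<subseteq> carrier R" using assms(3) \<phi>c by auto
  then have C: "subring C R" unfolding C_def by (rule R.generate_ring_is_subring)
  have E: "E \<subseteq> C" "\<phi> c \<in> C" for c unfolding C_def by (auto intro: generate_ring.incl)
  have "countable C" unfolding C_def by (intro countable_generate_ring countable_Un assms countable_image) simp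
  then have inj: "inj_on f C" unfolding f_def by (rule inj_on_to_nat_on)
  interpret i: ring_hom_cring ?R R "\<lambda>a. a" by (rule R.ring_hom_cring_incl[OF C])
  have iso: "f \<in> ring_iso ?R R\<^sub>0" unfolding R\<^sub>0_def by (rule inj_imp_image_ring_iso) (simp add: inj)
  \<comment> \<open>The transport lemma used next concerns the image ring with its zero overwritten
    by the image of zero; \<open>image_ring\<close> has this zero by construction.\<close>
  have "R\<^sub>0\<lparr>zero := f \<zero>\<^bsub>?R\<^esub>\<rparr> = R\<^sub>0" unfolding R\<^sub>0_def by (simp add: image_ring_def image_group_def monoid.defs)
  then have R0: "cring R\<^sub>0" using i.R.ring_iso_imp_img_cring[OF iso] by simp
  have "h \<in> ring_iso R\<^sub>0 ?R" using ring_iso_set_sym[OF i.R.ring_axioms iso] by (simp add: h_def)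
  then have "h \<in> ring_hom R\<^sub>0 ?R" and hb: "bij_betw h (carrier R\<^sub>0) C" by (auto simp: ring_iso_def)
  then have h: "h \<in> ring_hom R\<^sub>0 R" using subringE(1)[OF C] by (auto simp: ring_hom_def)
  have "f \<circ> \<phi> \<in> ring_hom type_ring R\<^sub>0"
  proof -
    have "\<phi> \<in> ring_hom type_ring ?R" using \<phi> E by (auto simp: ring_hom_def)
    then show ?thesis using iso ring_hom_trans unfolding ring_iso_def by blast
  qed
  then have 1: "k_algebra R\<^sub>0 (f \<circ> \<phi>)" using R0 by (simp add: k_algebra_def)
  have 2: "ring_hom_cring R\<^sub>0 R h"
    using R0 h by (simp add: ring_hom_cring_def ring_hom_cring_axioms_def R.is_cring)
  have 4: "(\<lambda>c. h ((f \<circ> \<phi>) c)) = \<phi>" using inj E by (simp add: h_def)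
  show thesis using that[OF 1 2 _ 4] hb E by (auto simp: bij_betw_def)
qed

lemma (in ring_hom_cring) mat_map_inj:
  assumes "inj_on h (carrier R)"
  shows "inj_on (mat_map n h) (carrier (Mat n R))"
proof (rule inj_onI)
  fix A B assume A: "A \<in> carrier (Mat n R)" and B: "B \<in> carrier (Mat n R)"
    and e: "mat_map n h A = mat_map n h B"
  show "A = B"
  proof (rule idx_eqI[OF Mat_extensional[OF A] Mat_extensional[OF B]])
    fix i j assume ij: "i < n" "j < n"
    have "h (A (i, j)) = h (B (i, j))" using fun_cong[OF e, of "(i, j)"] ij by (simp add: mat_map_apply)
    then show "A (i, j) = B (i, j)" using assms ij A B by (auto dest!: inj_onD intro: Mat_entry)
  qed
qed

text \<open>The entries of the inverse must be liftable too, since a matrix over a subring may be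
  invertible only over the larger ring. Injectivity then pulls both inverse identities back.\<close>

lemma (in ring_hom_cring) GL_lift:
  assumes inj: "inj_on h (carrier R)" and g: "g \<in> carrier (GL n S)"
    and im: "g ` idx n \<subseteq> h ` carrier R" "(inv\<^bsub>GL n S\<^esub> g) ` idx n \<subseteq> h ` carrier R"
  shows "g \<in> mat_map n h ` carrier (GL n R)"
proof -
  interpret G: group "GL n S" by (rule S.GL_group)
  let ?k = "inv_into (carrier R) h"
  have lift: "mat_map n ?k A \<in> carrier (Mat n R)" "mat_map n h (mat_map n ?k A) = A"
    if "A ` idx n \<subseteq> h ` carrier R" "A \<in> carrier (Mat n S)" for A
  proof -
    have A: "A (i, j) \<in> h ` carrier R" if "i < n" "j < n" for i j
      using that \<open>A ` idx n \<subseteq> h ` carrier R\<close> by auto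
    show "mat_map n ?k A \<in> carrier (Mat n R)"
      using A by (intro Mat_memI mat_map_extensional) (simp add: mat_map_apply inv_into_into)
    show "mat_map n h (mat_map n ?k A) = A"
      using A that(2) by (intro idx_eqI[OF mat_map_extensional Mat_extensional])
        (auto simp: mat_map_apply f_inv_into_f)
  qed
  let ?g = "mat_map n ?k g" and ?g' = "mat_map n ?k (inv\<^bsub>GL n S\<^esub> g)"
  note l = lift[OF im(1) GL_Mat[OF g]] lift[OF im(2) GL_Mat[OF G.inv_closed[OF g]]]
  note inj' = inj_onD[OF mat_map_inj[OF inj, of n]]
  interpret M: monoid "Mat n R" by (rule R.Mat_monoid)
  have "?g \<otimes>\<^bsub>Mat n R\<^esub> ?g' = \<one>\<^bsub>Mat n R\<^esub>"
    using mat_map_mult[OF l(1,3)] G.r_inv[OF g]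
    by (intro inj' R.Mat_mult_closed l M.one_closed) (simp add: l(2,4) mat_map_one GL_mult GL_one)
  moreover have "?g' \<otimes>\<^bsub>Mat n R\<^esub> ?g = \<one>\<^bsub>Mat n R\<^esub>"
    using mat_map_mult[OF l(3,1)] G.l_inv[OF g]
    by (intro inj' R.Mat_mult_closed l M.one_closed) (simp add: l(2,4) mat_map_one GL_mult GL_one)
  ultimately have "?g \<in> carrier (GL n R)" using l by (intro R.GL_memI(1)[of ?g n ?g'])
  then show ?thesis using l(2) by (intro image_eqI[of _ _ ?g]) simp_all
qed

lemma GL_countable_model:
  fixes \<phi> :: "'k::{field,countable} \<Rightarrow> 'r"
  assumes R: "k_algebra R \<phi>" and "countable \<G>" "\<G> \<subseteq> carrier (GL n R)"
  obtains R\<^sub>0 :: "nat ring" and \<phi>\<^sub>0 h where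
    "k_algebra R\<^sub>0 \<phi>\<^sub>0" "ring_hom_cring R\<^sub>0 R h" "inj_on h (carrier R\<^sub>0)"
    "(\<lambda>c. h (\<phi>\<^sub>0 c)) = \<phi>" "\<G> \<subseteq> mat_map n h ` carrier (GL n R\<^sub>0)"
proof -
  interpret R: cring R using R by (simp add: k_algebra_def)
  interpret G: group "GL n R" by (rule R.GL_group)
  let ?E = "\<Union>g\<in>\<G>. g ` idx n \<union> (inv\<^bsub>GL n R\<^esub> g) ` idx n"
  have "countable ?E" using assms(2) by (intro countable_UN countable_Un countable_image) auto
  moreover have "?E \<subseteq> carrier R"
  proof -
    have "g ` idx n \<union> (inv\<^bsub>GL n R\<^esub> g) ` idx n \<subseteq> carrier R" if "g \<in> \<G>" for g
      using Mat_entry[OF GL_Mat[of g n R]] Mat_entry[OF GL_Mat[of "inv\<^bsub>GL n R\<^esub> g" n R]] that assms(3) by auto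
    then show ?thesis by blast
  qed
  ultimately obtain R\<^sub>0 :: "nat ring" and \<phi>\<^sub>0 h where m:
    "k_algebra R\<^sub>0 \<phi>\<^sub>0" "ring_hom_cring R\<^sub>0 R h" "inj_on h (carrier R\<^sub>0)"
    "(\<lambda>c. h (\<phi>\<^sub>0 c)) = \<phi>" "?E \<subseteq> h ` carrier R\<^sub>0"
    by (rule k_algebra_countable_model[OF R])
  have "g \<in> mat_map n h ` carrier (GL n R\<^sub>0)" if "g \<in> \<G>" for g
  proof (rule ring_hom_cring.GL_lift[OF m(2,3)])
    show "g \<in> carrier (GL n R)" using that assms(3) by blast
    show "g ` idx n \<subseteq> h ` carrier R\<^sub>0" "(inv\<^bsub>GL n R\<^esub> g) ` idx n \<subseteq> h ` carrier R\<^sub>0"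
      by (rule order.trans[OF _ m(5)], use that in blast)+
  qed
  then show thesis using that[OF m(1-4)] by blast
qed

lemma k_algebra_closed: "k_algebra R \<phi> \<Longrightarrow> \<phi> c \<in> carrier R"
  by (auto simp: k_algebra_def ring_of_type_algebra_def intro: ring_hom_closed)

lemma pts_countable_model:
  fixes \<phi> :: "'k::{field,countable} \<Rightarrow> 'r"
  assumes R: "k_algebra R \<phi>" and E: "E \<subseteq> regular_funs n" and "countable \<G>" "\<G> \<subseteq> pts n E R \<phi>"
  obtains R\<^sub>0 :: "nat ring" and \<phi>\<^sub>0 h where
    "k_algebra R\<^sub>0 \<phi>\<^sub>0" "ring_hom_cring R\<^sub>0 R h" "(\<lambda>c. h (\<phi>\<^sub>0 c)) = \<phi>"
    "\<G> \<subseteq> mat_map n h ` pts n E R\<^sub>0 \<phi>\<^sub>0"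
proof -
  have "\<G> \<subseteq> carrier (GL n R)" using assms(4) by (auto simp: pts_def)
  then obtain R\<^sub>0 :: "nat ring" and \<phi>\<^sub>0 h where m:
    "k_algebra R\<^sub>0 \<phi>\<^sub>0" "ring_hom_cring R\<^sub>0 R h" "inj_on h (carrier R\<^sub>0)"
    "(\<lambda>c. h (\<phi>\<^sub>0 c)) = \<phi>" "\<G> \<subseteq> mat_map n h ` carrier (GL n R\<^sub>0)"
    by (rule GL_countable_model[OF R assms(3)])
  have "g \<in> mat_map n h ` pts n E R\<^sub>0 \<phi>\<^sub>0" if "g \<in> \<G>" for g
  proof -
    obtain g0 where "g0 \<in> carrier (GL n R\<^sub>0)" "g = mat_map n h g0" using m(5) \<open>g \<in> \<G>\<close> by blast
    then show ?thesis
      using ring_hom_cring.mat_map_pts_iff[OF m(2) k_algebra_closed[OF m(1)] E _ m(3)] m(4) that assms(4)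
      by auto
  qed
  then show thesis using that[OF m(1,2,4)] by blast
qed

lemma mat_map_pts_model:
  assumes "k_algebra R\<^sub>0 \<phi>\<^sub>0" "ring_hom_cring R\<^sub>0 R h" "(\<lambda>c. h (\<phi>\<^sub>0 c)) = \<phi>"
    and "E \<subseteq> regular_funs n" "g \<in> pts n E R\<^sub>0 \<phi>\<^sub>0"
  shows "mat_map n h g \<in> pts n E R \<phi>"
  using ring_hom_cring.mat_map_pts[OF assms(2) k_algebra_closed[OF assms(1)] assms(4,5)] assms(3) by simp

text \<open>Each subgroup axiom involves at most two points, so it can be checked over a countable
  model containing them and pushed forward again.\<close>

lemma algebraic_group_pts:
  fixes \<phi> :: "'k::{field,countable} \<Rightarrow> 'r"
  assumes E: "algebraic_group n E" and R: "k_algebra R \<phi>"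
  shows "subgroup (pts n E R \<phi>) (GL n R)"
proof -
  have reg: "E \<subseteq> regular_funs n" using E by (simp add: algebraic_group_def)
  interpret R: cring R using R by (simp add: k_algebra_def)
  interpret G: group "GL n R" by (rule R.GL_group)
  show ?thesis
  proof (rule G.subgroupI)
    show "pts n E R \<phi> \<subseteq> carrier (GL n R)" by (auto simp: pts_def)
    \<comment> \<open>No points are prescribed here: any model has an identity matrix among its
      points, and its image shows that the set is nonempty.\<close>
    obtain R\<^sub>0 :: "nat ring" and \<phi>\<^sub>0 h where m:
      "k_algebra R\<^sub>0 \<phi>\<^sub>0" "ring_hom_cring R\<^sub>0 R h" "(\<lambda>c. h (\<phi>\<^sub>0 c)) = \<phi>"
      using pts_countable_model[OF R reg, of "{}"] by auto
    have "subgroup (pts n E R\<^sub>0 \<phi>\<^sub>0) (GL n R\<^sub>0)" using E m(1) by (simp add: algebraic_group_def)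
    then show "pts n E R \<phi> \<noteq> {}"
      using mat_map_pts_model[OF m reg] subgroup.one_closed by blast
  next
    fix a b assume ab: "a \<in> pts n E R \<phi>" "b \<in> pts n E R \<phi>"
    have "countable {a, b}" "{a, b} \<subseteq> pts n E R \<phi>" using ab by auto
    then obtain R\<^sub>0 :: "nat ring" and \<phi>\<^sub>0 h where m:
      "k_algebra R\<^sub>0 \<phi>\<^sub>0" "ring_hom_cring R\<^sub>0 R h" "(\<lambda>c. h (\<phi>\<^sub>0 c)) = \<phi>"
      and "{a, b} \<subseteq> mat_map n h ` pts n E R\<^sub>0 \<phi>\<^sub>0"
      by (rule pts_countable_model[OF R reg])
    then obtain a0 b0 where ab0: "a0 \<in> pts n E R\<^sub>0 \<phi>\<^sub>0" "b0 \<in> pts n E R\<^sub>0 \<phi>\<^sub>0"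
      "a = mat_map n h a0" "b = mat_map n h b0" by auto
    have P: "subgroup (pts n E R\<^sub>0 \<phi>\<^sub>0) (GL n R\<^sub>0)" using E m(1) by (simp add: algebraic_group_def)
    interpret h: group_hom "GL n R\<^sub>0" "GL n R" "mat_map n h"
      by (rule ring_hom_cring.mat_map_group_hom[OF m(2)])
    note c = subgroup.mem_carrier[OF P ab0(1)] subgroup.mem_carrier[OF P ab0(2)]
    show "a \<otimes>\<^bsub>GL n R\<^esub> b \<in> pts n E R \<phi>"
      using mat_map_pts_model[OF m reg subgroup.m_closed[OF P ab0(1,2)]] ab0 c by simp
    show "inv\<^bsub>GL n R\<^esub> a \<in> pts n E R \<phi>"
      using mat_map_pts_model[OF m reg subgroup.m_inv_closed[OF P ab0(1)]] ab0 c by simp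
  qed
qed

lemma subscheme_pts:
  fixes \<phi> :: "'k::{field,countable} \<Rightarrow> 'r"
  assumes "subscheme n E E'" "E \<subseteq> regular_funs n" "E' \<subseteq> regular_funs n" and R: "k_algebra R \<phi>"
  shows "pts n E R \<phi> \<subseteq> pts n E' R \<phi>"
proof
  fix g assume "g \<in> pts n E R \<phi>"
  then have "countable {g}" "{g} \<subseteq> pts n E R \<phi>" by auto
  then obtain R\<^sub>0 :: "nat ring" and \<phi>\<^sub>0 h where m:
    "k_algebra R\<^sub>0 \<phi>\<^sub>0" "ring_hom_cring R\<^sub>0 R h" "(\<lambda>c. h (\<phi>\<^sub>0 c)) = \<phi>"
    and "{g} \<subseteq> mat_map n h ` pts n E R\<^sub>0 \<phi>\<^sub>0"
    by (rule pts_countable_model[OF R assms(2)])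
  moreover have "pts n E R\<^sub>0 \<phi>\<^sub>0 \<subseteq> pts n E' R\<^sub>0 \<phi>\<^sub>0" using assms(1) m(1) by (simp add: subscheme_def)
  ultimately show "g \<in> pts n E' R \<phi>" using mat_map_pts_model[OF m assms(3)] by auto
qed

text \<open>A point descends to a countable model, where the definition of a morphism applies. The
  value returns to \<open>R\<close> because the entries of \<rho> are regular functions and so
  commute with base change.\<close>

lemma group_mor_pts:
  fixes \<phi> :: "'k::{field,countable} \<Rightarrow> 'r"
  assumes "group_mor n E m E' \<rho>" "E \<subseteq> regular_funs n" "E' \<subseteq> regular_funs m" and R: "k_algebra R \<phi>"
    and g: "g \<in> pts n E R \<phi>"
  shows "mor_apply n m R \<phi> \<rho> g \<in> pts m E' R \<phi>"
proof -
  have "countable {g}" "{g} \<subseteq> pts n E R \<phi>" using g by auto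
  then obtain R\<^sub>0 :: "nat ring" and \<phi>\<^sub>0 h where m:
    "k_algebra R\<^sub>0 \<phi>\<^sub>0" "ring_hom_cring R\<^sub>0 R h" "(\<lambda>c. h (\<phi>\<^sub>0 c)) = \<phi>"
    and "{g} \<subseteq> mat_map n h ` pts n E R\<^sub>0 \<phi>\<^sub>0"
    by (rule pts_countable_model[OF R assms(2)])
  then obtain g0 where g0: "g0 \<in> pts n E R\<^sub>0 \<phi>\<^sub>0" "g = mat_map n h g0" by auto
  have "mor_apply n m R\<^sub>0 \<phi>\<^sub>0 \<rho> g0 \<in> pts m E' R\<^sub>0 \<phi>\<^sub>0"
    using assms(1) m(1) hom_in_carrier[of _ "pts_group n E R\<^sub>0 \<phi>\<^sub>0" "pts_group m E' R\<^sub>0 \<phi>\<^sub>0"] g0(1)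
    by (auto simp: group_mor_def)
  then have "mat_map m h (mor_apply n m R\<^sub>0 \<phi>\<^sub>0 \<rho> g0) \<in> pts m E' R \<phi>"
    by (rule mat_map_pts_model[OF m assms(3)])
  moreover have "mat_map m h (mor_apply n m R\<^sub>0 \<phi>\<^sub>0 \<rho> g0) = mor_apply n m R \<phi> \<rho> g"
  proof (rule idx_eqI[OF mat_map_extensional])
    show "mor_apply n m R \<phi> \<rho> g \<in> extensional (idx m)" by (simp add: mor_apply_def)
    fix i j assume "i < m" "j < m"
    moreover have "g0 \<in> carrier (GL n R\<^sub>0)" using g0(1) by (simp add: pts_def)
    ultimately show "mat_map m h (mor_apply n m R\<^sub>0 \<phi>\<^sub>0 \<rho> g0) (i, j) = mor_apply n m R \<phi> \<rho> g (i, j)"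
      using ring_hom_cring.hom_fun_eval[OF m(2) _ _ k_algebra_closed[OF m(1)], of g0 n "\<rho> (i, j)"]
        assms(1) g0(2)
      by (simp add: mat_map_apply mor_apply_def group_mor_def m(3))
  qed
  ultimately show ?thesis by simp
qed

section \<open>Completions of discrete valuation rings\<close>

lemma type_ring_simps [simp]:
  "carrier type_ring = UNIV" "a \<otimes>\<^bsub>type_ring\<^esub> b = a * b" "\<one>\<^bsub>type_ring\<^esub> = 1"
  "\<zero>\<^bsub>type_ring\<^esub> = 0" "a \<oplus>\<^bsub>type_ring\<^esub> b = a + b"
  by (simp_all add: ring_of_type_algebra_def)

lemma cring_type_ring: "cring type_ring"
  by (rule cring_from_type_algebra)

lemma type_ring_a_inv: "\<ominus>\<^bsub>type_ring\<^esub> a = - a"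
proof -
  interpret cring "type_ring :: 'a ring" by (rule cring_type_ring)
  show ?thesis by (rule minus_equality) simp_all
qed

lemma Units_loc_ring: "Units (loc_ring y) = {u \<in> y. u \<noteq> 0 \<and> inverse u \<in> y}"
proof -
  have "inverse u \<in> y \<and> u \<noteq> 0" if "v \<in> y" "v * u = 1" for u v :: 'a
    using that inverse_unique[of v u] by (metis inverse_inverse_eq inverse_unique mult.commute mult_zero_right zero_neq_one)
  moreover have "\<exists>v\<in>y. v * u = 1 \<and> u * v = 1" if "u \<noteq> 0" "inverse u \<in> y" for u :: 'a
    using that by (intro bexI[of _ "inverse u"]) auto
  ultimately show ?thesis by (auto simp: Units_def)
qed

text \<open>The part of the valuation theory that the completion uses, relative to one fixed
  uniformizer \<open>t\<close>: powers of the maximal ideal are generated by powers of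
  \<open>t\<close>, and a power of \<open>t\<close> clears the denominator of any element of the
  field.\<close>

locale valuation_ring =
  fixes y :: "'f::field set" and t :: 'f
  assumes zero: "0 \<in> y" and one: "1 \<in> y" and uminus: "a \<in> y \<Longrightarrow> - a \<in> y"
    and add: "a \<in> y \<Longrightarrow> b \<in> y \<Longrightarrow> a + b \<in> y" and mult: "a \<in> y \<Longrightarrow> b \<in> y \<Longrightarrow> a * b \<in> y"
    and t: "t \<in> y" "t \<noteq> 0" "inverse t \<notin> y"
    and max_ideal_pow_iff: "a \<in> max_ideal_pow y e \<longleftrightarrow> (\<exists>r\<in>y. a = r * t ^ e)"
    and denominator: "\<exists>c. z * t ^ c \<in> y"

text \<open>\<open>dvr\<close> does not say outright that its generator is a nonzero non-unit. Both
  follow from \<open>y \<noteq> UNIV\<close>, since otherwise the decomposition z = u t^e would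
  place every z in \<open>y\<close>.\<close>

lemma dvr_valuation_ring:
  assumes "dvr y"
  shows "\<exists>t. valuation_ring y t"
proof -
  obtain t where sub: "subring y type_ring" and y: "y \<noteq> UNIV" and t: "t \<in> y"
    and dec: "\<And>z. z \<noteq> 0 \<Longrightarrow> \<exists>u e. u \<in> Units (loc_ring y) \<and> z = u * t powi e"
    using assms unfolding dvr_def by blast
  have z: "0 \<in> y" "1 \<in> y" using subringE(2,3)[OF sub] by simp_all
  have uminus: "- a \<in> y" if "a \<in> y" for a
    using subringE(5)[OF sub that] by (simp add: type_ring_a_inv)
  have mult: "a * b \<in> y" if "a \<in> y" "b \<in> y" for a b using subringE(6)[OF sub that] by simp
  have add: "a + b \<in> y" if "a \<in> y" "b \<in> y" for a b using subringE(7)[OF sub that] by simp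
  have pow: "a ^ k \<in> y" if "a \<in> y" for a k by (induction k) (auto intro: z mult that)
  have unit: "u \<in> Units (loc_ring y) \<longleftrightarrow> u \<in> y \<and> u \<noteq> 0 \<and> inverse u \<in> y" for u
    by (auto simp: Units_loc_ring)
  have t0: "t \<noteq> 0"
  proof
    \<comment> \<open>A power of 0 vanishes unless the exponent is 0, when it is 1; so a nonzero z
      would be a unit of the local ring and lie in \<open>y\<close>.\<close>
    assume "t = 0"
    have "z \<in> y" for z
    proof (cases "z = 0")
      case False
      then obtain u e where "u \<in> Units (loc_ring y)" "z = u * t powi e" using dec by blast
      with False show ?thesis using unit \<open>t = 0\<close> by (cases "e = 0") auto
    qed (simp add: z)
    with y show False by blast
  qed
  have tinv: "inverse t \<notin> y"
  proof
    assume "inverse t \<in> y"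
    then have "t powi e \<in> y" for e
      using pow t by (cases "0 \<le> e") (auto simp: power_int_def power_inverse[symmetric])
    then have "z \<in> y" for z
      by (cases "z = 0") (use dec[of z] z unit mult in auto)
    with y show False by blast
  qed
  have t_unif: "y - Units (loc_ring y) = {r * t |r. r \<in> y}"
  proof (intro equalityI subsetI)
    fix z assume zy: "z \<in> y - Units (loc_ring y)"
    show "z \<in> {r * t |r. r \<in> y}"
    proof (cases "z = 0")
      case True
      then show ?thesis using z by force
    next
      case False
      then obtain u e where u: "u \<in> Units (loc_ring y)" "z = u * t powi e" using dec by blast
      have "0 < e"
      proof (rule ccontr)
        \<comment> \<open>Exponent 0 would make z a unit, and an exponent -(k+1) gives t^-1 = u^-1 z
          t^k, an element of \<open>y\<close>.\<close>
        assume "\<not> 0 < e"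
        moreover have "e \<noteq> 0" using u zy by auto
        ultimately obtain k where k: "e = - int (Suc k)"
          by (metis not_less_iff_gr_or_eq negD linorder_neqE)
        have "t powi e = inverse (t ^ Suc k)"
          by (simp only: k power_int_minus power_int_of_nat)
        then have "inverse t = inverse u * z * t ^ k"
          using u(2) unit[of u] u(1) t0 by (simp add: field_simps)
        then show False using tinv u(1) unit zy pow t mult by simp
      qed
      then obtain k where k: "e = int (Suc k)" by (metis pos_int_cases Suc_pred')
      have "t powi e = t ^ Suc k" by (simp only: k power_int_of_nat)
      then have "z = (u * t ^ k) * t" using u(2) by simp
      then show ?thesis using u(1) unit pow t mult by blast
    qed
  next
    fix z assume "z \<in> {r * t |r. r \<in> y}"
    then obtain r where r: "r \<in> y" "z = r * t" by blast
    have "z \<notin> Units (loc_ring y)"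
    proof
      assume "z \<in> Units (loc_ring y)"
      then have "r * inverse z \<in> y" "r \<noteq> 0" using unit r mult by auto
      then show False using tinv r t0 by (simp add: field_simps)
    qed
    then show "z \<in> y - Units (loc_ring y)" using r t mult by simp
  qed
  have P: "PIdl\<^bsub>loc_ring y\<^esub> a = {r * a |r. r \<in> y}" for a by (auto simp: cgenideal_def)
  have "a \<in> max_ideal_pow y e \<longleftrightarrow> (\<exists>r\<in>y. a = r * t ^ e)" for a e
  proof
    assume "a \<in> max_ideal_pow y e"
    then obtain t' r where t': "t' \<in> y" "y - Units (loc_ring y) = {r * t' |r. r \<in> y}" and r: "r \<in> y" "a = r * t' ^ e"
      by (auto simp: max_ideal_pow_def uniformizer_def P)
    \<comment> \<open>\<open>max_ideal_pow\<close> admits any uniformizer t'. Being a non-unit, t'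
      equals b t, so t'^e is a multiple of t^e.\<close>
    have "t' \<in> y - Units (loc_ring y)" unfolding t'(2) using z by force
    then obtain b where b: "b \<in> y" "t' = b * t" unfolding t_unif by blast
    have "a = (r * b ^ e) * t ^ e" using r b by (simp add: power_mult_distrib)
    then show "\<exists>r\<in>y. a = r * t ^ e" using r b pow mult by blast
  next
    assume "\<exists>r\<in>y. a = r * t ^ e"
    then show "a \<in> max_ideal_pow y e"
      using t t_unif by (auto simp: max_ideal_pow_def uniformizer_def P)
  qed
  moreover have "\<exists>c. z * t ^ c \<in> y" for z
  proof (cases "z = 0")
    case False
    then obtain u e where u: "u \<in> Units (loc_ring y)" "z = u * t powi e" using dec by blast
    \<comment> \<open>Only the negative part of e has to be cleared, which \<open>nat (- e)\<close>
      measures.\<close>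
    have "z * t ^ nat (- e) = u * t ^ nat e"
      using u(2) t0 by (cases "0 \<le> e") (auto simp: power_int_def field_simps power_inverse)
    then show ?thesis using u(1) unit pow t mult by metis
  qed (use z in auto)
  ultimately have "valuation_ring y t"
    by unfold_locales (use z uminus add mult t t0 tinv in auto)
  then show ?thesis ..
qed

section \<open>Cauchy sequences and null sequences\<close>

context valuation_ring
begin

lemma pow: "a \<in> y \<Longrightarrow> a ^ k \<in> y"
  by (induction k) (auto intro: one mult)

lemma diff: "a \<in> y \<Longrightarrow> b \<in> y \<Longrightarrow> a - b \<in> y"
  using add[of a "- b"] uminus[of b] by simp

lemma mip_zero: "0 \<in> max_ideal_pow y e"
  using zero by (force simp: max_ideal_pow_iff)

lemma mip_add: "a \<in> max_ideal_pow y e \<Longrightarrow> b \<in> max_ideal_pow y e \<Longrightarrow> a + b \<in> max_ideal_pow y e"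
  unfolding max_ideal_pow_iff by (metis add distrib_right)

lemma mip_uminus: "a \<in> max_ideal_pow y e \<Longrightarrow> - a \<in> max_ideal_pow y e"
  unfolding max_ideal_pow_iff by (metis uminus mult_minus_left)

lemma mip_diff: "a \<in> max_ideal_pow y e \<Longrightarrow> b \<in> max_ideal_pow y e \<Longrightarrow> a - b \<in> max_ideal_pow y e"
  using mip_add[of a e "- b"] mip_uminus[of b e] by simp

lemma mip_0: "max_ideal_pow y 0 = y"
  by (auto simp: max_ideal_pow_iff)

text \<open>The element z has a pole of order at most c, so multiplication by it costs at most c
  powers of \<open>t\<close>.\<close>

lemma mip_mult:
  assumes "z * t ^ c \<in> y" "a \<in> max_ideal_pow y (e + c)"
  shows "z * a \<in> max_ideal_pow y e"
proof -
  obtain r where "r \<in> y" "a = r * t ^ (e + c)" using assms(2) by (auto simp: max_ideal_pow_iff)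
  then have "z * a = (r * (z * t ^ c)) * t ^ e" by (simp add: power_add algebra_simps)
  then show ?thesis unfolding max_ideal_pow_iff using mult \<open>r \<in> y\<close> assms(1) by blast
qed

text \<open>Past the Cauchy bound for exponent 0, all terms differ from \<open>a M\<close> by
  elements of \<open>y\<close>; a denominator of that single term serves for all of them.\<close>

lemma cauchy_bounded:
  assumes "a \<in> cauchy_seqs y"
  obtains c M where "\<And>i. i \<ge> M \<Longrightarrow> a i * t ^ c \<in> y"
proof -
  obtain M where M: "\<And>i j. i \<ge> M \<Longrightarrow> j \<ge> M \<Longrightarrow> a i - a j \<in> y"
    using assms mip_0 unfolding cauchy_seqs_def by blast
  obtain c where c: "a M * t ^ c \<in> y" using denominator by blast
  have "a i * t ^ c \<in> y" if "i \<ge> M" for i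
  proof -
    have "a i * t ^ c = (a i - a M) * t ^ c + a M * t ^ c" by (simp add: algebra_simps)
    then show ?thesis using M[OF that, of M] c t pow by (simp add: add mult)
  qed
  then show thesis by (rule that)
qed

lemma cauchy_const: "(\<lambda>_. z) \<in> cauchy_seqs y"
  by (simp add: cauchy_seqs_def mip_zero)

lemma cauchy_add:
  assumes a: "a \<in> cauchy_seqs y" and b: "b \<in> cauchy_seqs y"
  shows "(\<lambda>i. a i + b i) \<in> cauchy_seqs y"
  unfolding cauchy_seqs_def
proof safe
  fix e
  obtain M where M: "\<And>i j. i \<ge> M \<Longrightarrow> j \<ge> M \<Longrightarrow> a i - a j \<in> max_ideal_pow y e"
    using a unfolding cauchy_seqs_def by blast
  obtain M' where M': "\<And>i j. i \<ge> M' \<Longrightarrow> j \<ge> M' \<Longrightarrow> b i - b j \<in> max_ideal_pow y e"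
    using b unfolding cauchy_seqs_def by blast
  have "(a i - a j) + (b i - b j) \<in> max_ideal_pow y e" if "i \<ge> max M M'" "j \<ge> max M M'" for i j
    using that by (intro mip_add M M') auto
  then have "\<forall>i\<ge>max M M'. \<forall>j\<ge>max M M'. a i + b i - (a j + b j) \<in> max_ideal_pow y e"
    by (simp add: add_diff_add)
  then show "\<exists>M. \<forall>i\<ge>M. \<forall>j\<ge>M. a i + b i - (a j + b j) \<in> max_ideal_pow y e" by blast
qed

lemma cauchy_mult:
  assumes a: "a \<in> cauchy_seqs y" and b: "b \<in> cauchy_seqs y"
  shows "(\<lambda>i. a i * b i) \<in> cauchy_seqs y"
  unfolding cauchy_seqs_def
proof safe
  fix e
  obtain c M where c: "\<And>i. i \<ge> M \<Longrightarrow> a i * t ^ c \<in> y"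
    using cauchy_bounded[OF a] by blast
  obtain c' M' where c': "\<And>i. i \<ge> M' \<Longrightarrow> b i * t ^ c' \<in> y"
    using cauchy_bounded[OF b] by blast
  \<comment> \<open>In the product rule below each difference is multiplied by a term of the other
    sequence. The shifts by c' and c make room for the poles of these terms.\<close>
  obtain L where L: "\<And>i j. i \<ge> L \<Longrightarrow> j \<ge> L \<Longrightarrow> a i - a j \<in> max_ideal_pow y (e + c')"
    using a unfolding cauchy_seqs_def by blast
  obtain L' where L': "\<And>i j. i \<ge> L' \<Longrightarrow> j \<ge> L' \<Longrightarrow> b i - b j \<in> max_ideal_pow y (e + c)"
    using b unfolding cauchy_seqs_def by blast
  let ?N = "max (max M M') (max L L')"
  have "a i * b i - a j * b j \<in> max_ideal_pow y e" if "i \<ge> ?N" "j \<ge> ?N" for i j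
  proof -
    have "a i * (b i - b j) + b j * (a i - a j) \<in> max_ideal_pow y e"
      using that by (intro mip_add mip_mult[OF c L'] mip_mult[OF c' L]) auto
    then show ?thesis by (simp add: algebra_simps)
  qed
  then show "\<exists>M. \<forall>i\<ge>M. \<forall>j\<ge>M. a i * b i - a j * b j \<in> max_ideal_pow y e" by blast
qed

lemma cauchy_uminus: "a \<in> cauchy_seqs y \<Longrightarrow> (\<lambda>i. - a i) \<in> cauchy_seqs y"
  using cauchy_mult[OF cauchy_const[of "- 1"]] by simp

lemma null_add:
  assumes a: "a \<in> null_seqs y" and b: "b \<in> null_seqs y"
  shows "(\<lambda>i. a i + b i) \<in> null_seqs y"
  unfolding null_seqs_def
proof safe
  fix e
  obtain M where M: "\<And>i. i \<ge> M \<Longrightarrow> a i \<in> max_ideal_pow y e"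
    using a unfolding null_seqs_def by blast
  obtain M' where M': "\<And>i. i \<ge> M' \<Longrightarrow> b i \<in> max_ideal_pow y e"
    using b unfolding null_seqs_def by blast
  have "\<forall>i\<ge>max M M'. a i + b i \<in> max_ideal_pow y e" by (auto intro: mip_add M M')
  then show "\<exists>M. \<forall>i\<ge>M. a i + b i \<in> max_ideal_pow y e" by blast
qed

lemma null_mult:
  assumes a: "a \<in> cauchy_seqs y" and b: "b \<in> null_seqs y"
  shows "(\<lambda>i. a i * b i) \<in> null_seqs y"
  unfolding null_seqs_def
proof safe
  fix e
  obtain c M where c: "\<And>i. i \<ge> M \<Longrightarrow> a i * t ^ c \<in> y" using cauchy_bounded[OF a] by blast
  obtain M' where M': "\<And>i. i \<ge> M' \<Longrightarrow> b i \<in> max_ideal_pow y (e + c)"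
    using b unfolding null_seqs_def by blast
  have "\<forall>i\<ge>max M M'. a i * b i \<in> max_ideal_pow y e" by (auto intro: mip_mult c M')
  then show "\<exists>M. \<forall>i\<ge>M. a i * b i \<in> max_ideal_pow y e" by blast
qed

lemma null_zero: "(\<lambda>_. 0) \<in> null_seqs y"
  by (simp add: null_seqs_def mip_zero)

lemma null_cauchy: "null_seqs y \<subseteq> cauchy_seqs y"
  unfolding null_seqs_def cauchy_seqs_def by (blast intro: mip_diff)

section \<open>The quotient by null sequences and its integral subring\<close>

lemma cring_cauchy_ring: "cring (cauchy_ring y)"
proof (intro cringI abelian_groupI comm_monoidI)
  fix a assume "a \<in> carrier (cauchy_ring y)"
  then show "\<exists>b\<in>carrier (cauchy_ring y). b \<oplus>\<^bsub>cauchy_ring y\<^esub> a = \<zero>\<^bsub>cauchy_ring y\<^esub>"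
    by (intro bexI[of _ "\<lambda>i. - a i"]) (auto simp: cauchy_ring_def cauchy_uminus)
qed (auto simp: cauchy_ring_def cauchy_add cauchy_mult cauchy_const algebra_simps)

sublocale C: cring "cauchy_ring y" by (rule cring_cauchy_ring)

lemma cauchy_ring_a_inv: "a \<in> cauchy_seqs y \<Longrightarrow> \<ominus>\<^bsub>cauchy_ring y\<^esub> a = (\<lambda>i. - a i)"
  by (rule C.minus_equality) (auto simp: cauchy_ring_def cauchy_uminus)

lemma null_seqs_ideal: "ideal (null_seqs y) (cauchy_ring y)"
proof (rule idealI[OF C.ring_axioms])
  show "subgroup (null_seqs y) (add_monoid (cauchy_ring y))"
  proof (rule C.add.subgroupI)
    fix a assume a: "a \<in> null_seqs y"
    then have "(\<lambda>i. (- 1) * a i) \<in> null_seqs y" by (intro null_mult cauchy_const)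
    then show "\<ominus>\<^bsub>cauchy_ring y\<^esub> a \<in> null_seqs y"
      using a null_cauchy by (subst cauchy_ring_a_inv) auto
  qed (use null_cauchy null_zero null_add in \<open>auto simp: cauchy_ring_def\<close>)
next
  fix a x assume "a \<in> null_seqs y" "x \<in> carrier (cauchy_ring y)"
  then have "(\<lambda>i. x i * a i) \<in> null_seqs y" by (intro null_mult) (auto simp: cauchy_ring_def)
  then show "x \<otimes>\<^bsub>cauchy_ring y\<^esub> a \<in> null_seqs y" "a \<otimes>\<^bsub>cauchy_ring y\<^esub> x \<in> null_seqs y"
    by (simp_all add: cauchy_ring_def mult.commute)
qed

sublocale N: ideal "null_seqs y" "cauchy_ring y" by (rule null_seqs_ideal)

lemma cring_Fhat: "cring (Fhat y)"
  unfolding Fhat_def by (rule N.quotient_is_cring[OF cring_cauchy_ring])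

sublocale F: cring "Fhat y" by (rule cring_Fhat)

lemma completed_class_hom: "ring_hom_cring (cauchy_ring y) (Fhat y) (completed_class y)"
proof -
  have "completed_class y = (+>\<^bsub>cauchy_ring y\<^esub>) (null_seqs y)" by (auto simp: completed_class_def)
  then show ?thesis
    using N.rcos_ring_hom cring_cauchy_ring cring_Fhat
    by (simp add: ring_hom_cring_def ring_hom_cring_axioms_def Fhat_def)
qed

sublocale cl: ring_hom_cring "cauchy_ring y" "Fhat y" "completed_class y"
  by (rule completed_class_hom)

lemma completed_class_eqD:
  assumes "completed_class y a = completed_class y b"
  shows "(\<lambda>i. a i - b i) \<in> null_seqs y"
proof -
  have "a \<in> completed_class y a"
    using null_zero by (force simp: completed_class_def a_r_coset_def' cauchy_ring_def)
  then obtain c where "c \<in> null_seqs y" "a = (\<lambda>i. c i + b i)"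
    unfolding assms by (auto simp: completed_class_def a_r_coset_def' cauchy_ring_def)
  then show ?thesis by simp
qed

lemma subring_Ohat: "subring (carrier (Ohat y)) (Fhat y)"
proof -
  have "subring {a \<in> cauchy_seqs y. \<forall>i. a i \<in> y} (cauchy_ring y)"
    using cauchy_ring_a_inv
    by (intro C.subringI)
      (auto simp: cauchy_uminus cauchy_add cauchy_mult cauchy_const uminus one add mult cauchy_ring_def)
  then have "subring (completed_class y ` {a \<in> cauchy_seqs y. \<forall>i. a i \<in> y}) (Fhat y)"
    by (intro ring_hom_ring.img_is_subring[OF ring_hom_ringI2[OF C.ring_axioms F.ring_axioms cl.homh]])
  then show ?thesis by (simp add: Ohat_def)
qed

lemma Ohat_eq: "Ohat y = (Fhat y)\<lparr>carrier := carrier (Ohat y)\<rparr>"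
  by (simp add: Ohat_def)

lemma Ohat_incl: "ring_hom_cring (Ohat y) (Fhat y) (\<lambda>a. a)"
  using F.ring_hom_cring_incl[OF subring_Ohat] by (simp add: Ohat_eq[symmetric])

lemma cring_Ohat: "cring (Ohat y)"
  using Ohat_incl by (simp add: ring_hom_cring_def)

lemma to_Fhat_hom: "ring_hom_cring type_ring (Fhat y) (to_Fhat y)"
proof -
  have "to_Fhat y = completed_class y \<circ> (\<lambda>z _. z)" by (auto simp: to_Fhat_def)
  moreover have "(\<lambda>z _. z) \<in> ring_hom type_ring (cauchy_ring y)"
    by (auto simp: ring_hom_def cauchy_ring_def cauchy_const)
  ultimately have "to_Fhat y \<in> ring_hom type_ring (Fhat y)"
    using ring_hom_trans cl.homh by metis
  then show ?thesis
    by (simp add: ring_hom_cring_def ring_hom_cring_axioms_def cring_Fhat cring_type_ring)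
qed

lemma to_Fhat_Ohat: "z \<in> y \<Longrightarrow> to_Fhat y z \<in> carrier (Ohat y)"
  by (auto simp: to_Fhat_def Ohat_def cauchy_const)

text \<open>A uniformizer of \<open>\<O>\<^sub>y\<close> divides the uniformizer \<open>t\<close> of the local ring, which is invertible in \<open>F\<^sub>y\<close>.\<close>

lemma uniformizer_Units:
  assumes "uniformizer (Ohat y) p"
  shows "p \<in> Units (Fhat y)"
proof -
  interpret O: cring "Ohat y" by (rule cring_Ohat)
  interpret i: ring_hom_cring "Ohat y" "Fhat y" "\<lambda>a. a" by (rule Ohat_incl)
  interpret e: ring_hom_cring type_ring "Fhat y" "to_Fhat y" by (rule to_Fhat_hom)
  let ?t = "to_Fhat y t"
  have tO: "?t \<in> carrier (Ohat y)" using t by (simp add: to_Fhat_Ohat)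
  have "?t \<notin> Units (Ohat y)"
  proof
    assume "?t \<in> Units (Ohat y)"
    then obtain b where "b \<in> carrier (Ohat y)" "b \<otimes>\<^bsub>Fhat y\<^esub> ?t = \<one>\<^bsub>Fhat y\<^esub>"
      by (auto simp: Units_def Ohat_def)
    then obtain a where a: "a \<in> cauchy_seqs y" "\<And>i. a i \<in> y"
      and e: "completed_class y a \<otimes>\<^bsub>Fhat y\<^esub> ?t = \<one>\<^bsub>Fhat y\<^esub>"
      by (auto simp: Ohat_def)
    \<comment> \<open>If an integral sequence inverted t, some a_i t - 1 would equal r t with r in
      \<open>y\<close>, and t^-1 = a_i - r would lie in \<open>y\<close>.\<close>
    have "completed_class y (a \<otimes>\<^bsub>cauchy_ring y\<^esub> (\<lambda>_. t)) = completed_class y \<one>\<^bsub>cauchy_ring y\<^esub>"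
      using a e cauchy_const[of t] cl.hom_one
      by (subst cl.hom_mult) (simp_all add: to_Fhat_def cauchy_ring_def)
    from completed_class_eqD[OF this] obtain i where "a i * t - 1 \<in> max_ideal_pow y 1"
      unfolding null_seqs_def cauchy_ring_def by auto
    then obtain r where r: "r \<in> y" "a i * t - 1 = r * t" by (auto simp: max_ideal_pow_iff)
    then have "inverse t = a i - r" using t by (simp add: field_simps)
    then show False using t a r diff by simp
  qed
  \<comment> \<open>All non-units of the completed local ring are multiples of \<open>p\<close>, so
    t = r p; multiplying by the image of t^-1 exhibits an inverse of \<open>p\<close> in
    \<open>Fhat y\<close>.\<close>
  then have "?t \<in> PIdl\<^bsub>Ohat y\<^esub> p" using assms tO by (auto simp: uniformizer_def)
  then obtain r where "r \<in> carrier (Ohat y)" "?t = r \<otimes>\<^bsub>Ohat y\<^esub> p"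
    by (auto simp: cgenideal_def)
  moreover have "monoid.mult (Ohat y) = monoid.mult (Fhat y)" by (simp add: Ohat_def)
  ultimately have r: "r \<in> carrier (Fhat y)" "?t = r \<otimes>\<^bsub>Fhat y\<^esub> p"
    using i.hom_closed by simp_all
  have p: "p \<in> carrier (Fhat y)" using assms i.hom_closed by (simp add: uniformizer_def)
  let ?s = "to_Fhat y (inverse t)"
  have s: "?s \<in> carrier (Fhat y)" by (rule e.hom_closed) simp
  have "?s \<otimes>\<^bsub>Fhat y\<^esub> ?t = \<one>\<^bsub>Fhat y\<^esub>"
    using e.hom_mult[of "inverse t" t] e.hom_one t by simp
  then have "(?s \<otimes>\<^bsub>Fhat y\<^esub> r) \<otimes>\<^bsub>Fhat y\<^esub> p = \<one>\<^bsub>Fhat y\<^esub>"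
    using r s p by (simp add: F.m_assoc)
  then show ?thesis
    using r s p F.m_comm[of "?s \<otimes>\<^bsub>Fhat y\<^esub> r" p] F.m_closed[OF s r(1)] unfolding Units_def by auto
qed

end

section \<open>Adeles and level groups\<close>

text \<open>A zero coefficient leaves an empty support and hence an empty sum, which is why \<phi>
  must send 0 to 0.\<close>

lemma pol_eval_const:
  assumes "\<phi> 0 = (0::'a::comm_ring_1)"
  shows "pol_eval type_ring \<phi> p (Poly_Mapping.single 0 c) = \<phi> c"
proof -
  interpret cring "type_ring :: 'a ring" by (rule cring_type_ring)
  show ?thesis
    using assms finsum_insert[of "{}" "0 :: 'v \<Rightarrow>\<^sub>0 nat"] finsum_empty
    by (cases "c = 0") (auto simp: pol_eval_def finprod_empty)
qed

text \<open>A constant is the quotient of the degree 0 forms c and 1, and the form 1 vanishes at no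
  point.\<close>

lemma constants_in_closed_points:
  assumes emb: "emb \<in> ring_hom type_ring type_ring" and y: "y \<in> closed_points emb N s"
  shows "emb c \<in> y"
proof -
  interpret e: ring_hom_cring type_ring type_ring emb
    by (simp add: ring_hom_cring_def ring_hom_cring_axioms_def cring_type_ring emb)
  have e: "emb 0 = 0" "emb 1 = 1" using e.hom_zero e.hom_one by simp_all
  obtain p where p: "y = local_ring_at emb N s p" using y by (auto simp: closed_points_def)
  have f: "form N 0 (Poly_Mapping.single 0 a)" for a
    by (auto simp: homogeneous_def pol_vars_def)
  have "emb c = pol_eval type_ring emb s (Poly_Mapping.single 0 c) / pol_eval type_ring emb s (Poly_Mapping.single 0 1)"
    by (simp add: pol_eval_const e del: single_one)
  moreover have "pol_eval type_ring to_ac p (Poly_Mapping.single 0 1) \<noteq> 0"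
    by (simp add: pol_eval_const del: single_one)
  ultimately show ?thesis unfolding p local_ring_at_def using f by blast
qed

lemma ring_hom_k_algebra:
  assumes "k_algebra R \<phi>" "ring_hom_cring R S h"
  shows "k_algebra S (\<lambda>c. h (\<phi> c))"
  using assms ring_hom_trans[of \<phi> type_ring R h S]
  by (auto simp: k_algebra_def ring_hom_cring_def ring_hom_cring_axioms_def o_def)

lemma subgroup_vimage:
  assumes "group_hom A B h" "subgroup P A" "subgroup Q B"
  shows "subgroup {g \<in> P. h g \<in> Q} A"
proof -
  interpret group_hom A B h by fact
  interpret P: subgroup P A by fact
  interpret Q: subgroup Q B by fact
  have "\<one>\<^bsub>A\<^esub> \<in> {g \<in> P. h g \<in> Q}" by simp
  then have "{g \<in> P. h g \<in> Q} \<noteq> {}" by blast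
  then show ?thesis by (intro G.subgroupI) auto
qed

text \<open>Applied to \<open>Ohat y\<close> in \<open>Fhat y\<close> and to the adeles in the full
  product. Matrices over \<open>R\<close> are literally matrices over \<open>S\<close>, so the
  general linear groups can be compared as sets, with no map between them.\<close>

locale subring_incl = ring_hom_cring R S "\<lambda>a. a" for R (structure) and S (structure)
begin

lemma mat_map_GL_id: "g \<in> carrier (GL n R) \<Longrightarrow> mat_map n (\<lambda>a. a) g = g"
  by (rule mat_map_id[OF GL_extensional])

lemma GL_incl: "carrier (GL n R) \<subseteq> carrier (GL n S)"
  using hom_in_carrier[OF mat_map_GL] mat_map_GL_id by force

lemma GL_incl_hom: "group_hom (GL n R) (GL n S) (\<lambda>g. g)"
proof -
  interpret h: group_hom "GL n R" "GL n S" "mat_map n (\<lambda>a. a)" by (rule mat_map_group_hom)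
  have "(\<lambda>g. g) \<in> hom (GL n R) (GL n S)"
  proof (rule homI)
    fix g g' assume g: "g \<in> carrier (GL n R)" "g' \<in> carrier (GL n R)"
    then show "g \<otimes>\<^bsub>GL n R\<^esub> g' = g \<otimes>\<^bsub>GL n S\<^esub> g'"
      using h.hom_mult[OF g] h.G.m_closed[OF g] by (simp add: mat_map_GL_id)
  qed (use GL_incl in blast)
  then show ?thesis
    by (simp add: group_hom_def group_hom_axioms_def R.GL_group S.GL_group)
qed

lemma GL_incl_inv: "g \<in> carrier (GL n R) \<Longrightarrow> inv\<^bsub>GL n S\<^esub> g = inv\<^bsub>GL n R\<^esub> g"
  using group_hom.hom_inv[OF GL_incl_hom] by metis

lemma GL_incl_subgroup: "subgroup P (GL n R) \<Longrightarrow> subgroup P (GL n S)"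
  using group_hom.subgroup_img_is_subgroup[OF GL_incl_hom] by fastforce

lemma pts_incl:
  assumes "\<And>c. \<phi> c \<in> carrier R" "E \<subseteq> regular_funs n" "g \<in> pts n E R \<phi>"
  shows "g \<in> pts n E S \<phi>"
  using mat_map_pts[OF assms] mat_map_GL_id[of g n] assms(3) by (simp add: pts_def)

lemma GL_restrict:
  assumes "g \<in> carrier (GL n S)"
    and "\<And>i j. i < n \<Longrightarrow> j < n \<Longrightarrow> g (i, j) \<in> carrier R"
    and "\<And>i j. i < n \<Longrightarrow> j < n \<Longrightarrow> (inv\<^bsub>GL n S\<^esub> g) (i, j) \<in> carrier R"
  shows "g \<in> carrier (GL n R)"
proof -
  have "g \<in> mat_map n (\<lambda>a. a) ` carrier (GL n R)"
    by (rule GL_lift) (use assms in \<open>auto simp: inj_on_def\<close>)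
  then show ?thesis by (auto simp: mat_map_GL_id)
qed

lemma pts_restrict:
  assumes "\<And>c. \<phi> c \<in> carrier R" "E \<subseteq> regular_funs n" "g \<in> carrier (GL n R)" "g \<in> pts n E S \<phi>"
  shows "g \<in> pts n E R \<phi>"
  using mat_map_pts_iff[OF assms(1-3)] mat_map_GL_id[OF assms(3)] assms(4) by (simp add: inj_on_def)

end

text \<open>What is retained of the curve: a valuation ring at each point, containing the constants.
  Countability of \<open>'k\<close> serves the descent to algebras carried by \<open>nat\<close>;
  the finite field of the theorem is an instance.\<close>

locale curve_points =
  fixes Y :: "'f::field set set" and emb :: "'k::{field,countable} \<Rightarrow> 'f"
  assumes valuation: "y \<in> Y \<Longrightarrow> \<exists>t. valuation_ring y t"
    and emb: "emb \<in> ring_hom type_ring type_ring"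
    and constants: "y \<in> Y \<Longrightarrow> emb c \<in> y"
begin

abbreviation \<phi> where "\<phi> y \<equiv> (\<lambda>c. to_Fhat y (emb c))"

lemma k_algebra_emb: "k_algebra type_ring emb"
  by (simp add: k_algebra_def cring_type_ring emb)

lemma completion:
  assumes "y \<in> Y"
  shows "cring (Fhat y)" "cring (Ohat y)" "subring_incl (Ohat y) (Fhat y)"
    "ring_hom_cring type_ring (Fhat y) (to_Fhat y)" "k_algebra (Fhat y) (\<phi> y)" "k_algebra (Ohat y) (\<phi> y)"
proof -
  obtain t where "valuation_ring y t" using valuation[OF assms] by blast
  then interpret valuation_ring y t .
  show "cring (Fhat y)" "cring (Ohat y)" "subring_incl (Ohat y) (Fhat y)"
    "ring_hom_cring type_ring (Fhat y) (to_Fhat y)"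
    by (simp_all add: cring_Fhat cring_Ohat subring_incl_def Ohat_incl to_Fhat_hom)
  show F: "k_algebra (Fhat y) (\<phi> y)" by (rule ring_hom_k_algebra[OF k_algebra_emb to_Fhat_hom])
  have "\<phi> y c \<in> carrier (Ohat y)" for c by (rule to_Fhat_Ohat[OF constants[OF assms]])
  then show "k_algebra (Ohat y) (\<phi> y)"
    using F cring_Ohat by (auto simp: k_algebra_def ring_hom_def Ohat_def)
qed

section \<open>The product ring and the adele ring\<close>

lemma cring_prod_ring: "cring (prod_ring Y)"
proof (intro cringI abelian_groupI comm_monoidI)
  fix a assume a: "a \<in> carrier (prod_ring Y)"
  have "(\<lambda>y\<in>Y. \<ominus>\<^bsub>Fhat y\<^esub> a y) \<in> carrier (prod_ring Y)"
    using a completion(1) cring.cring_simprules(3) by (fastforce simp: prod_ring_def PiE_iff)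
  moreover have "(\<lambda>y\<in>Y. \<ominus>\<^bsub>Fhat y\<^esub> a y) \<oplus>\<^bsub>prod_ring Y\<^esub> a = \<zero>\<^bsub>prod_ring Y\<^esub>"
    using a completion(1) cring.cring_simprules(9) by (fastforce simp: prod_ring_def PiE_iff intro!: restrict_ext)
  ultimately show "\<exists>b\<in>carrier (prod_ring Y). b \<oplus>\<^bsub>prod_ring Y\<^esub> a = \<zero>\<^bsub>prod_ring Y\<^esub>" by blast
qed (use completion(1) in \<open>auto simp: prod_ring_def PiE_iff cring.cring_simprules
  monoid.r_one[OF ring.is_monoid[OF cring.axioms(1)]] intro!: restrict_ext extensionalityI[of _ Y]\<close>)

sublocale P: cring "prod_ring Y" by (rule cring_prod_ring)

lemma proj_hom:
  assumes "y \<in> Y"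
  shows "ring_hom_cring (prod_ring Y) (Fhat y) (\<lambda>a. a y)"
  using assms completion(1)[OF assms] cring_prod_ring
  by (auto simp: ring_hom_cring_def ring_hom_cring_axioms_def ring_hom_def prod_ring_def)

lemma diag_hom: "ring_hom_cring type_ring (prod_ring Y) (diag Y)"
proof -
  note h = ring_hom_cring.homh[OF completion(4)]
  have "diag Y \<in> ring_hom type_ring (prod_ring Y)"
    using ring_hom_closed[OF h] ring_hom_mult[OF h] ring_hom_add[OF h] ring_hom_one[OF h]
    by (intro ring_hom_memI) (auto simp: diag_def prod_ring_def intro!: restrict_ext)
  then show ?thesis
    by (simp add: ring_hom_cring_def ring_hom_cring_axioms_def cring_type_ring cring_prod_ring)
qed

lemma Ohat_subring: "y \<in> Y \<Longrightarrow> subring (carrier (Ohat y)) (Fhat y)"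
  using valuation valuation_ring.subring_Ohat by blast

lemma prod_ring_a_inv:
  assumes "a \<in> carrier (prod_ring Y)" "y \<in> Y"
  shows "(\<ominus>\<^bsub>prod_ring Y\<^esub> a) y = \<ominus>\<^bsub>Fhat y\<^esub> a y"
  using ring_hom_cring.hom_a_inv[OF proj_hom[OF assms(2)] assms(1)] .

lemma adele_ring_subring: "subring (carrier (adele_ring Y)) (prod_ring Y)"
proof -
  let ?bad = "\<lambda>a. {y \<in> Y. a y \<notin> carrier (Ohat y)}"
  have c: "carrier (adele_ring Y) = {a \<in> carrier (prod_ring Y). finite (?bad a)}"
    by (simp add: adele_ring_def)
  note O = subringE[OF Ohat_subring]
  show ?thesis
    unfolding c
  proof (rule P.subringI)
    have "?bad \<one>\<^bsub>prod_ring Y\<^esub> = {}" using O(3) by (auto simp: prod_ring_def)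
    then show "\<one>\<^bsub>prod_ring Y\<^esub> \<in> {a \<in> carrier (prod_ring Y). finite (?bad a)}"
      by (simp only: mem_Collect_eq P.one_closed finite.emptyI simp_thms)
  next
    fix a assume a: "a \<in> {a \<in> carrier (prod_ring Y). finite (?bad a)}"
    have "?bad (\<ominus>\<^bsub>prod_ring Y\<^esub> a) \<subseteq> ?bad a" using a O(5) by (auto simp: prod_ring_a_inv)
    then show "\<ominus>\<^bsub>prod_ring Y\<^esub> a \<in> {a \<in> carrier (prod_ring Y). finite (?bad a)}"
      using a by (auto intro: finite_subset)
  next
    fix a b assume ab: "a \<in> {a \<in> carrier (prod_ring Y). finite (?bad a)}"
      "b \<in> {a \<in> carrier (prod_ring Y). finite (?bad a)}"
    have "?bad (a \<otimes>\<^bsub>prod_ring Y\<^esub> b) \<subseteq> ?bad a \<union> ?bad b" "?bad (a \<oplus>\<^bsub>prod_ring Y\<^esub> b) \<subseteq> ?bad a \<union> ?bad b"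
      using O(6,7) by (auto simp: prod_ring_def)
    then show "a \<otimes>\<^bsub>prod_ring Y\<^esub> b \<in> {a \<in> carrier (prod_ring Y). finite (?bad a)}"
      "a \<oplus>\<^bsub>prod_ring Y\<^esub> b \<in> {a \<in> carrier (prod_ring Y). finite (?bad a)}"
      using ab by (auto intro: finite_subset[of _ "?bad a \<union> ?bad b"])
  qed auto
qed

lemma adele_incl: "subring_incl (adele_ring Y) (prod_ring Y)"
proof -
  have "adele_ring Y = (prod_ring Y)\<lparr>carrier := carrier (adele_ring Y)\<rparr>" by (simp add: adele_ring_def)
  then show ?thesis
    using P.ring_hom_cring_incl[OF adele_ring_subring] by (simp add: subring_incl_def)
qed

lemma diag_emb_adele: "diag Y (emb c) \<in> carrier (adele_ring Y)"
proof -
  have bad: "{y \<in> Y. diag Y (emb c) y \<notin> carrier (Ohat y)} = {}"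
    using k_algebra_closed[OF completion(6)] by (auto simp: diag_def)
  have "diag Y (emb c) \<in> carrier (prod_ring Y)"
    using ring_hom_closed[OF ring_hom_cring.homh[OF diag_hom]] by simp
  moreover have "finite {y \<in> Y. diag Y (emb c) y \<notin> carrier (Ohat y)}"
    by (simp only: bad finite.emptyI)
  ultimately show ?thesis by (simp add: adele_ring_def)
qed

lemma ambient_group: "group (ambient n Y)"
  by (rule P.GL_group)

lemma GL_completion_group: "y \<in> Y \<Longrightarrow> group (GL n (Fhat y))"
  by (rule cring.GL_group[OF completion(1)])

lemma component_hom: "y \<in> Y \<Longrightarrow> group_hom (ambient n Y) (GL n (Fhat y)) (component n y)"
proof -
  have "component n y = mat_map n (\<lambda>a. a y)" by (auto simp: component_def)
  then show "group_hom (ambient n Y) (GL n (Fhat y)) (component n y)" if "y \<in> Y"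
    using ring_hom_cring.mat_map_group_hom[OF proj_hom[OF that]] by simp
qed

lemma component_apply: "i < n \<Longrightarrow> j < n \<Longrightarrow> component n y g (i, j) = g (i, j) y"
  by (simp add: component_def mat_map_apply)

lemma component_extensional: "component n y g \<in> extensional (idx n)"
  by (simp add: component_def mat_map_extensional)

lemma Mat_prod_eqI:
  assumes g: "g \<in> carrier (Mat n (prod_ring Y))" and g': "g' \<in> carrier (Mat n (prod_ring Y))"
    and e: "\<And>y. y \<in> Y \<Longrightarrow> component n y g = component n y g'"
  shows "g = g'"
proof (rule idx_eqI[OF Mat_extensional[OF g] Mat_extensional[OF g']])
  fix i j assume ij: "i < n" "j < n"
  have "g (i, j) \<in> extensional Y" "g' (i, j) \<in> extensional Y"
    using Mat_entry[OF g ij] Mat_entry[OF g' ij] by (auto simp: prod_ring_def PiE_def)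
  moreover have "g (i, j) y = g' (i, j) y" if "y \<in> Y" for y
    using fun_cong[OF e[OF that], of "(i, j)"] ij by (simp add: component_apply)
  ultimately show "g (i, j) = g' (i, j)" by (rule extensionalityI)
qed

lemma component_glue:
  assumes "\<And>y. y \<in> Y \<Longrightarrow> m y \<in> carrier (Mat n (Fhat y))"
  shows "(\<lambda>ij\<in>idx n. \<lambda>y\<in>Y. m y ij) \<in> carrier (Mat n (prod_ring Y))"
    and "y \<in> Y \<Longrightarrow> component n y (\<lambda>ij\<in>idx n. \<lambda>y\<in>Y. m y ij) = m y"
proof -
  show "(\<lambda>ij\<in>idx n. \<lambda>y\<in>Y. m y ij) \<in> carrier (Mat n (prod_ring Y))"
    using Mat_entry[OF assms] by (intro Mat_memI) (auto simp: prod_ring_def)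
  assume y: "y \<in> Y"
  show "component n y (\<lambda>ij\<in>idx n. \<lambda>y\<in>Y. m y ij) = m y"
    by (rule idx_eqI[OF component_extensional Mat_extensional[OF assms[OF y]]])
      (simp add: component_apply y)
qed

text \<open>The inverse is glued from the local inverses, and both identities are checked component
  by component.\<close>

lemma ambient_glue:
  assumes m: "\<And>y. y \<in> Y \<Longrightarrow> m y \<in> carrier (GL n (Fhat y))"
  shows "(\<lambda>ij\<in>idx n. \<lambda>y\<in>Y. m y ij) \<in> carrier (ambient n Y)" (is "?g \<in> _")
proof -
  let ?g' = "\<lambda>ij\<in>idx n. \<lambda>y\<in>Y. (inv\<^bsub>GL n (Fhat y)\<^esub> m y) ij"
  have i: "inv\<^bsub>GL n (Fhat y)\<^esub> m y \<in> carrier (GL n (Fhat y))" if "y \<in> Y" for y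
    using group.inv_closed[OF GL_completion_group m] that by blast
  note g = component_glue[of m, OF GL_Mat[OF m]]
  note g' = component_glue[of "\<lambda>y. inv\<^bsub>GL n (Fhat y)\<^esub> m y", OF GL_Mat[OF i]]
  interpret M: monoid "Mat n (prod_ring Y)" by (rule P.Mat_monoid)
  have c: "component n y (a \<otimes>\<^bsub>Mat n (prod_ring Y)\<^esub> b) = component n y a \<otimes>\<^bsub>Mat n (Fhat y)\<^esub> component n y b"
    "component n y \<one>\<^bsub>Mat n (prod_ring Y)\<^esub> = \<one>\<^bsub>Mat n (Fhat y)\<^esub>"
    if "y \<in> Y" "a \<in> carrier (Mat n (prod_ring Y))" "b \<in> carrier (Mat n (prod_ring Y))" for a b y
    using ring_hom_cring.mat_map_mult[OF proj_hom[OF that(1)] that(2,3)]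
      ring_hom_cring.mat_map_one[OF proj_hom[OF that(1)]] by (auto simp: component_def)
  show ?thesis
  proof (rule P.GL_memI(1)[OF g(1) g'(1)])
    show "?g \<otimes>\<^bsub>Mat n (prod_ring Y)\<^esub> ?g' = \<one>\<^bsub>Mat n (prod_ring Y)\<^esub>"
    proof (rule Mat_prod_eqI[OF M.m_closed[OF g(1) g'(1)] M.one_closed])
      fix y assume y: "y \<in> Y"
      show "component n y (?g \<otimes>\<^bsub>Mat n (prod_ring Y)\<^esub> ?g') = component n y \<one>\<^bsub>Mat n (prod_ring Y)\<^esub>"
        using c(1)[OF y g(1) g'(1)] c(2)[OF y g(1) g'(1)] group.r_inv[OF GL_completion_group[OF y] m[OF y]]
        by (simp add: g(2)[OF _ y] g'(2)[OF _ y] GL_mult GL_one)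
    qed
    show "?g' \<otimes>\<^bsub>Mat n (prod_ring Y)\<^esub> ?g = \<one>\<^bsub>Mat n (prod_ring Y)\<^esub>"
    proof (rule Mat_prod_eqI[OF M.m_closed[OF g'(1) g(1)] M.one_closed])
      fix y assume y: "y \<in> Y"
      show "component n y (?g' \<otimes>\<^bsub>Mat n (prod_ring Y)\<^esub> ?g) = component n y \<one>\<^bsub>Mat n (prod_ring Y)\<^esub>"
        using c(1)[OF y g'(1) g(1)] c(2)[OF y g(1) g'(1)] group.l_inv[OF GL_completion_group[OF y] m[OF y]]
        by (simp add: g(2)[OF _ y] g'(2)[OF _ y] GL_mult GL_one)
    qed
  qed
qed

lemma k_algebra_prod: "k_algebra (prod_ring Y) (\<lambda>c. diag Y (emb c))"
  by (rule ring_hom_k_algebra[OF k_algebra_emb diag_hom])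

lemma diag_component: "y \<in> Y \<Longrightarrow> diag Y z y = to_Fhat y z"
  by (simp add: diag_def)

lemma pts_prodI:
  assumes E: "E \<subseteq> regular_funs n" and g: "g \<in> carrier (ambient n Y)"
    and c: "\<And>y. y \<in> Y \<Longrightarrow> component n y g \<in> pts n E (Fhat y) (\<phi> y)"
  shows "g \<in> pts n E (prod_ring Y) (\<lambda>c. diag Y (emb c))"
proof -
  have "fun_eval n (prod_ring Y) (\<lambda>c. diag Y (emb c)) f g = \<zero>\<^bsub>prod_ring Y\<^esub>" if f: "f \<in> E" for f
  proof (rule extensionalityI)
    have "fun_eval n (prod_ring Y) (\<lambda>c. diag Y (emb c)) f g \<in> carrier (prod_ring Y)"
      using f E g by (intro P.fun_eval_closed k_algebra_closed[OF k_algebra_prod]) auto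
    then show "fun_eval n (prod_ring Y) (\<lambda>c. diag Y (emb c)) f g \<in> extensional Y"
      by (simp add: prod_ring_def PiE_def)
    show "\<zero>\<^bsub>prod_ring Y\<^esub> \<in> extensional Y" by (simp add: prod_ring_def)
    fix y assume y: "y \<in> Y"
    have "fun_eval n (prod_ring Y) (\<lambda>c. diag Y (emb c)) f g y = fun_eval n (Fhat y) (\<phi> y) f (component n y g)"
      using ring_hom_cring.hom_fun_eval[OF proj_hom[OF y] g _ k_algebra_closed[OF k_algebra_prod], of f] f E y
      by (auto simp: component_def diag_component)
    also have "\<dots> = \<zero>\<^bsub>Fhat y\<^esub>" using c[OF y] f by (simp add: pts_def)
    finally show "fun_eval n (prod_ring Y) (\<lambda>c. diag Y (emb c)) f g y = \<zero>\<^bsub>prod_ring Y\<^esub> y"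
      using y by (simp add: prod_ring_def)
  qed
  then show ?thesis using g by (simp add: pts_def)
qed

lemma adelic_points_ambient: "adelic_points n E emb Y \<subseteq> carrier (ambient n Y)"
  using subring_incl.GL_incl[OF adele_incl] by (auto simp: adelic_points_def pts_def)

text \<open>Integrality at every point leaves an empty set of bad places for each entry, so the
  finiteness condition is met. The equations hold because they hold in each factor of the product
  ring.\<close>

lemma adelic_pointsI:
  assumes E: "E \<subseteq> regular_funs n" and g: "g \<in> carrier (ambient n Y)"
    and c: "\<And>y. y \<in> Y \<Longrightarrow> component n y g \<in> pts n E (Ohat y) (\<phi> y)"
  shows "g \<in> adelic_points n E emb Y"
proof -
  have integral: "h (i, j) \<in> carrier (adele_ring Y)"
    if h: "h \<in> carrier (ambient n Y)" and O: "\<And>y. y \<in> Y \<Longrightarrow> component n y h \<in> carrier (GL n (Ohat y))"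
      and ij: "i < n" "j < n" for h i j
  proof -
    have "h (i, j) y \<in> carrier (Ohat y)" if "y \<in> Y" for y
      using Mat_entry[OF GL_Mat[OF O[OF that]] ij] ij by (simp add: component_apply)
    then have "{y \<in> Y. h (i, j) y \<notin> carrier (Ohat y)} = {}" by blast
    then have "finite {y \<in> Y. h (i, j) y \<notin> carrier (Ohat y)}" by (simp only: finite.emptyI)
    then show ?thesis using Mat_entry[OF GL_Mat[OF h] ij] by (simp add: adele_ring_def)
  qed
  have gO: "component n y g \<in> carrier (GL n (Ohat y))" if "y \<in> Y" for y
    using c[OF that] by (simp add: pts_def)
  \<comment> \<open>The inverse entries must be adelic too. The component of the inverse is the
    inverse in GL over \<open>Fhat y\<close>, which agrees with the one over
    \<open>Ohat y\<close>.\<close>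
  have "component n y (inv\<^bsub>ambient n Y\<^esub> g) \<in> carrier (GL n (Ohat y))" if y: "y \<in> Y" for y
    using group_hom.hom_inv[OF component_hom[OF y] g] subring_incl.GL_incl_inv[OF completion(3)[OF y] gO[OF y]]
      group.inv_closed[OF cring.GL_group[OF completion(2)[OF y]] gO[OF y]] by simp
  then have "g \<in> carrier (GL n (adele_ring Y))"
    using g gO group.inv_closed[OF ambient_group g] by (intro subring_incl.GL_restrict[OF adele_incl] integral)
  moreover have "component n y g \<in> pts n E (Fhat y) (\<phi> y)" if y: "y \<in> Y" for y
    by (rule subring_incl.pts_incl[OF completion(3)[OF y] k_algebra_closed[OF completion(6)[OF y]] E c[OF y]])
  then have "g \<in> pts n E (prod_ring Y) (\<lambda>c. diag Y (emb c))"
    by (rule pts_prodI[OF E g])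
  ultimately show ?thesis
    unfolding adelic_points_def by (intro subring_incl.pts_restrict[OF adele_incl diag_emb_adele E])
qed

section \<open>Rational points and level groups\<close>

lemma rational_points_subgroup:
  assumes "algebraic_group n E"
  shows "subgroup (rational_points n E emb Y) (ambient n Y)"
  unfolding rational_points_def
  by (rule group_hom.subgroup_img_is_subgroup[OF ring_hom_cring.mat_map_group_hom[OF diag_hom]
        algebraic_group_pts[OF assms k_algebra_emb]])

lemma local_level_pts: "local_level n E emb \<pi> D H y \<subseteq> pts n E (Ohat y) (\<phi> y)"
  by (auto simp: local_level_def Let_def)

lemma reduction:
  fixes d :: nat
  assumes y: "y \<in> Y" and p: "p \<in> carrier (Ohat y)"
  defines "J \<equiv> PIdl\<^bsub>Ohat y\<^esub> (p [^]\<^bsub>Ohat y\<^esub> d)"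
  shows "ring_hom_cring (Ohat y) (Ohat y Quot J) (\<lambda>a. J +>\<^bsub>Ohat y\<^esub> a)"
    and "k_algebra (Ohat y Quot J) (\<lambda>c. J +>\<^bsub>Ohat y\<^esub> \<phi> y c)"
proof -
  interpret O: cring "Ohat y" by (rule completion(2)[OF y])
  interpret J: ideal J "Ohat y" unfolding J_def by (intro O.cgenideal_ideal O.nat_pow_closed p)
  show h: "ring_hom_cring (Ohat y) (Ohat y Quot J) (\<lambda>a. J +>\<^bsub>Ohat y\<^esub> a)"
    using J.rcos_ring_hom J.quotient_is_cring[OF O.is_cring]
    by (simp add: ring_hom_cring_def ring_hom_cring_axioms_def O.is_cring)
  show "k_algebra (Ohat y Quot J) (\<lambda>c. J +>\<^bsub>Ohat y\<^esub> \<phi> y c)"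
    by (rule ring_hom_k_algebra[OF completion(6)[OF y] h])
qed

text \<open>With ramification this is the preimage, under reduction, of the points of
  \<open>H y\<close> over the quotient ring. Those points form a subgroup by the extension of the
  group axioms to arbitrary k-algebras.\<close>

lemma local_level_subgroup:
  assumes y: "y \<in> Y" and \<pi>: "\<pi> y \<in> carrier (Ohat y)"
    and E: "algebraic_group n E" and H: "D y \<noteq> 0 \<Longrightarrow> algebraic_group n (H y)"
  shows "subgroup (local_level n E emb \<pi> D H y) (GL n (Fhat y))"
proof (rule subring_incl.GL_incl_subgroup[OF completion(3)[OF y]])
  have GO: "subgroup (pts n E (Ohat y) (\<phi> y)) (GL n (Ohat y))"
    by (rule algebraic_group_pts[OF E completion(6)[OF y]])
  show "subgroup (local_level n E emb \<pi> D H y) (GL n (Ohat y))"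
  proof (cases "D y = 0")
    case False
    show ?thesis
      using subgroup_vimage[OF ring_hom_cring.mat_map_group_hom[OF reduction(1)[OF y \<pi>]] GO
          algebraic_group_pts[OF H[OF False] reduction(2)[OF y \<pi>]]] False
      by (simp add: local_level_def Let_def)
  qed (use GO in \<open>simp add: local_level_def Let_def\<close>)
qed

lemma local_level_mono:
  assumes y: "y \<in> Y" and \<pi>: "\<pi> y \<in> carrier (Ohat y)"
    and H: "D y \<noteq> 0 \<Longrightarrow> H y \<subseteq> regular_funs n" "D y \<noteq> 0 \<Longrightarrow> H' y \<subseteq> regular_funs n"
      "D y \<noteq> 0 \<Longrightarrow> subscheme n (H y) (H' y)"
  shows "local_level n E emb \<pi> D H y \<subseteq> local_level n E emb \<pi> D H' y"
proof (cases "D y = 0")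
  case False
  then show ?thesis
    using subscheme_pts[OF H(3) H(1) H(2) reduction(2)[OF y \<pi>]]
    by (auto simp: local_level_def Let_def)
qed (simp add: local_level_def)

text \<open>The local conditions force integrality everywhere, so the adelic condition follows from
  them; the level group becomes a plain product of local subgroups.\<close>

lemma level_group_eq:
  assumes "E \<subseteq> regular_funs n"
  shows "level_group n E emb Y \<pi> D H
    = {g \<in> carrier (ambient n Y). \<forall>y\<in>Y. component n y g \<in> local_level n E emb \<pi> D H y}"
  using adelic_points_ambient adelic_pointsI[OF assms] local_level_pts[of n E \<pi> D H]
  unfolding level_group_def by blast

text \<open>As a unit of \<open>Fhat x\<close>, the uniformizer is a point of GL 1, the scheme with
  no equations. The cocharacter, specified only on algebras carried by \<open>nat\<close>, is
  applied to it through \<open>group_mor_pts\<close>.\<close>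

lemma local_hecke_GL:
  assumes x: "x \<in> Y" and \<pi>: "uniformizer (Ohat x) (\<pi> x)"
    and \<mu>: "cocharacter n T \<mu>" and T: "T \<subseteq> regular_funs n"
  shows "local_hecke n emb \<pi> x \<mu> \<in> carrier (GL n (Fhat x))"
proof -
  interpret F: cring "Fhat x" by (rule completion(1)[OF x])
  obtain t where "valuation_ring x t" using valuation[OF x] by blast
  then have u: "\<pi> x \<in> Units (Fhat x)" using \<pi> by (rule valuation_ring.uniformizer_Units)
  let ?u = "\<lambda>ij\<in>idx 1. \<pi> x" and ?v = "\<lambda>ij\<in>idx 1. inv\<^bsub>Fhat x\<^esub> \<pi> x"
  have "?u \<in> carrier (GL 1 (Fhat x))"
  proof (rule F.GL_memI(1))
    show "?u \<in> carrier (Mat 1 (Fhat x))" "?v \<in> carrier (Mat 1 (Fhat x))"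
      using u by (auto simp: Mat_carrier)
    have s: "(\<Oplus>\<^bsub>Fhat x\<^esub>l\<in>{..<1::nat}. c) = c" if "c \<in> carrier (Fhat x)" for c
      using that F.finsum_insert[of "{}" "0::nat" "\<lambda>_. c"] by (simp add: lessThan_Suc)
    show "?u \<otimes>\<^bsub>Mat 1 (Fhat x)\<^esub> ?v = \<one>\<^bsub>Mat 1 (Fhat x)\<^esub>" "?v \<otimes>\<^bsub>Mat 1 (Fhat x)\<^esub> ?u = \<one>\<^bsub>Mat 1 (Fhat x)\<^esub>"
      using u s[of "\<one>\<^bsub>Fhat x\<^esub>"] by (auto intro!: restrict_ext simp: Mat_def lessThan_Suc)
  qed
  then have "?u \<in> pts 1 {} (Fhat x) (\<phi> x)" by (simp add: pts_def)
  then have "mor_apply 1 n (Fhat x) (\<phi> x) \<mu> ?u \<in> pts n T (Fhat x) (\<phi> x)"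
    using \<mu> T completion(5)[OF x] unfolding cocharacter_def by (intro group_mor_pts) auto
  then show ?thesis by (simp add: local_hecke_def pts_def)
qed

text \<open>The set \<open>S\<close> of places carrying a condition varies: all of \<open>Y\<close>
  gives the level group, and \<open>Y\<close> without \<open>x\<close> gives the subgroup of
  conditions away from \<open>x\<close>.\<close>

abbreviation restricted_product where
  "restricted_product n S L \<equiv> {g \<in> carrier (ambient n Y). \<forall>y\<in>S. component n y g \<in> L y}"

lemma restricted_product_subgroup:
  assumes S: "S \<subseteq> Y" and L: "\<And>y. y \<in> S \<Longrightarrow> subgroup (L y) (GL n (Fhat y))"
  shows "subgroup (restricted_product n S L) (ambient n Y)"
proof -
  interpret A: group "ambient n Y" by (rule ambient_group)
  note c = component_hom[OF subsetD[OF S]]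
  show ?thesis
  proof (rule A.subgroupI)
    have "component n y \<one>\<^bsub>ambient n Y\<^esub> \<in> L y" if "y \<in> S" for y
      using group_hom.hom_one[OF c[OF that]] subgroup.one_closed[OF L[OF that]] by simp
    then show "restricted_product n S L \<noteq> {}" using A.one_closed by blast
  next
    fix a assume a: "a \<in> restricted_product n S L"
    have "component n y (inv\<^bsub>ambient n Y\<^esub> a) \<in> L y" if "y \<in> S" for y
      using group_hom.hom_inv[OF c[OF that]] subgroup.m_inv_closed[OF L[OF that]] a that by simp
    then show "inv\<^bsub>ambient n Y\<^esub> a \<in> restricted_product n S L" using a by simp
  next
    fix a b assume ab: "a \<in> restricted_product n S L" "b \<in> restricted_product n S L"
    have "component n y (a \<otimes>\<^bsub>ambient n Y\<^esub> b) \<in> L y" if "y \<in> S" for y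
      using group_hom.hom_mult[OF c[OF that]] subgroup.m_closed[OF L[OF that]] ab that by simp
    then show "a \<otimes>\<^bsub>ambient n Y\<^esub> b \<in> restricted_product n S L" using ab by simp
  qed blast
qed

text \<open>Extension of \<open>d\<close> by the identity at the other places. It provides preimages
  under projection to the component at \<open>x\<close>, and the Hecke element has the same
  form.\<close>

definition local_element where
  "local_element n x d = (\<lambda>ij\<in>idx n. \<lambda>y\<in>Y. (if y = x then d else \<one>\<^bsub>GL n (Fhat y)\<^esub>) ij)"

lemma local_element:
  assumes "x \<in> Y" "d \<in> carrier (GL n (Fhat x))"
  shows "local_element n x d \<in> carrier (ambient n Y)"
    and "y \<in> Y \<Longrightarrow> component n y (local_element n x d) = (if y = x then d else \<one>\<^bsub>GL n (Fhat y)\<^esub>)"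
proof -
  have m: "(if y = x then d else \<one>\<^bsub>GL n (Fhat y)\<^esub>) \<in> carrier (GL n (Fhat y))" if "y \<in> Y" for y
    using assms monoid.one_closed[OF group.is_monoid[OF GL_completion_group[OF that]]] by simp
  show "local_element n x d \<in> carrier (ambient n Y)"
    unfolding local_element_def by (rule ambient_glue[OF m])
  show "component n y (local_element n x d) = (if y = x then d else \<one>\<^bsub>GL n (Fhat y)\<^esub>)" if "y \<in> Y"
    unfolding local_element_def by (rule component_glue(2)[OF GL_Mat[OF m] that])
qed

lemma restricted_product_component:
  assumes x: "x \<in> Y" and L: "\<And>y. y \<in> Y \<Longrightarrow> subgroup (L y) (GL n (Fhat y))"
  shows "component n x ` restricted_product n Y L = L x"
proof (intro equalityI subsetI)
  fix l assume l: "l \<in> L x"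
  note d = local_element[OF x subgroup.mem_carrier[OF L[OF x] l]]
  have "component n y (local_element n x l) \<in> L y" if "y \<in> Y" for y
    using d(2)[OF that] l subgroup.one_closed[OF L[OF that]] by simp
  then show "l \<in> component n x ` restricted_product n Y L"
    using d(1) d(2)[OF x] by (intro image_eqI[of _ _ "local_element n x l"]) simp_all
qed (use x in blast)

text \<open>The abstract comparison is applied with the conditions at the places other than
  \<open>x\<close> as \<open>M\<close> and \<open>M'\<close>. The extension of \<open>d\<close>
  satisfies them at both levels because each local subgroup contains the identity.\<close>

lemma hecke_cosets_restricted_product:
  assumes x: "x \<in> Y" and d: "d \<in> carrier (GL n (Fhat x))"
    and L: "\<And>y. y \<in> Y \<Longrightarrow> subgroup (L y) (GL n (Fhat y))"
    and L': "\<And>y. y \<in> Y \<Longrightarrow> subgroup (L' y) (GL n (Fhat y))"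
    and le: "\<And>y. y \<in> Y \<Longrightarrow> L y \<subseteq> L' y"
    and loc: "bij_betw (\<lambda>C. C <#>\<^bsub>GL n (Fhat x)\<^esub> L' x) (hecke_cosets (GL n (Fhat x)) (L x) d)
      (hecke_cosets (GL n (Fhat x)) (L' x) d)"
  shows "bij_betw (\<lambda>C. C <#>\<^bsub>ambient n Y\<^esub> restricted_product n Y L')
    (hecke_cosets (ambient n Y) (restricted_product n Y L) (local_element n x d))
    (hecke_cosets (ambient n Y) (restricted_product n Y L') (local_element n x d))"
proof (rule hecke_cosets_local_global[OF ambient_group GL_completion_group[OF x]])
  note e = local_element[OF x d]
  have mem: "local_element n x d \<in> restricted_product n (Y - {x}) M"
    if "\<And>y. y \<in> Y \<Longrightarrow> subgroup (M y) (GL n (Fhat y))" for M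
    using e(1) e(2) subgroup.one_closed[OF that] by simp
  show "local_element n x d \<in> restricted_product n (Y - {x}) L"
    "local_element n x d \<in> restricted_product n (Y - {x}) L'"
    by (rule mem[OF L] mem[OF L'], assumption)+
  show "component n x \<in> hom (ambient n Y) (GL n (Fhat x))"
    using component_hom[OF x] by (rule group_hom.homh)
  show "subgroup (restricted_product n (Y - {x}) L) (ambient n Y)"
    "subgroup (restricted_product n (Y - {x}) L') (ambient n Y)"
    "subgroup (restricted_product n Y L) (ambient n Y)" "subgroup (restricted_product n Y L') (ambient n Y)"
    using L L' by (auto intro!: restricted_product_subgroup)
  show "subgroup (L x) (GL n (Fhat x))" "subgroup (L' x) (GL n (Fhat x))" using L L' x by auto
  show "component n x ` restricted_product n Y L = L x" "component n x ` restricted_product n Y L' = L' x"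
    by (rule restricted_product_component[OF x L] restricted_product_component[OF x L'], assumption)+
  show "restricted_product n Y L = {g \<in> restricted_product n (Y - {x}) L. component n x g \<in> L x}"
    "restricted_product n Y L' = {g \<in> restricted_product n (Y - {x}) L'. component n x g \<in> L' x}"
    using x by auto
  show "restricted_product n Y L \<subseteq> restricted_product n Y L'" using le by blast
  show "bij_betw (\<lambda>C. C <#>\<^bsub>GL n (Fhat x)\<^esub> L' x)
      (hecke_cosets (GL n (Fhat x)) (L x) (component n x (local_element n x d)))
      (hecke_cosets (GL n (Fhat x)) (L' x) (component n x (local_element n x d)))"
    using loc e(2)[OF x] by simp
qed

lemma adelic_hecke_local_element: "adelic_hecke n emb Y \<pi> x \<mu> = local_element n x (local_hecke n emb \<pi> x \<mu>)"
  unfolding adelic_hecke_def local_element_def by (intro restrict_ext) (simp add: GL_one)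

end

lemma bij_betw_Pair:
  assumes "bij_betw f A B"
  shows "bij_betw (\<lambda>(v, C). (h v, f C)) ({a} \<times> A) ({h a} \<times> B)"
  using assms by (auto simp: bij_betw_def inj_on_def image_iff)

theorem proposition3p9:
  fixes emb :: "'k::{field,finite} \<Rightarrow> 'f::field"
    and N :: nat and s :: "nat \<Rightarrow> 'f" and Y :: "'f set set" and x :: "'f set"
    and n :: nat and G T :: "'k regfun set"
    and P :: "(nat \<times> nat \<Rightarrow> 'k regfun) set" and \<mu> :: "nat \<times> nat \<Rightarrow> 'k regfun"
    and \<pi> :: "'f set \<Rightarrow> 'f completed"
    and D :: "'f set \<Rightarrow> nat" and H1 H2 :: "'f set \<Rightarrow> 'k regfun set"
    and K1 K2 :: "(nat \<times> nat \<Rightarrow> 'f adele) set" and \<Delta> :: "nat \<times> nat \<Rightarrow> 'f adele"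
    and rep1 rep2 :: "'f vertex \<Rightarrow> nat \<times> nat \<Rightarrow> 'f adele"
    and \<Gamma>1 \<Gamma>2 :: "('f vertex, 'f edge) pre_digraph"
  assumes "smooth_projective_curve emb N s"
    and "Y = closed_points emb N s"
    and "x \<in> Y"
    and "connected_reductive n G" and "split_maximal_torus n G T"
    and "positive_system n G T P" and "dominant_cocharacter n T P \<mu>"
    and "\<forall>y\<in>Y. uniformizer (Ohat y) (\<pi> y)"
    and "effective_divisor Y D"
    and "ramification_datum n G D H1" and "ramification_datum n G D H2"
    and "\<forall>y. D y \<noteq> 0 \<longrightarrow> subscheme n (H1 y) (H2 y)"
    and "K1 = level_group n G emb Y \<pi> D H1" and "K2 = level_group n G emb Y \<pi> D H2"
    and "\<Delta> = adelic_hecke n emb Y \<pi> x \<mu>"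
    and "representatives n G emb Y K1 rep1" and "representatives n G emb Y K2 rep2"
    and "\<Gamma>1 = hecke_graph n G emb Y K1 \<Delta> rep1" and "\<Gamma>2 = hecke_graph n G emb Y K2 \<Delta> rep2"
    and "bij_betw (\<lambda>C. C <#>\<^bsub>GL n (Fhat x)\<^esub> local_level n G emb \<pi> D H2 x)
           (hecke_cosets (GL n (Fhat x)) (local_level n G emb \<pi> D H1 x) (component n x \<Delta>))
           (hecke_cosets (GL n (Fhat x)) (local_level n G emb \<pi> D H2 x) (component n x \<Delta>))"
  shows "vertex_map n Y K2 ` verts \<Gamma>1 = verts \<Gamma>2 \<and>
    (\<forall>a\<in>verts \<Gamma>2. \<forall>b\<in>verts \<Gamma>2. \<forall>a'\<in>verts \<Gamma>1. vertex_map n Y K2 a' = a \<longrightarrow>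
       transports n G emb Y K2 (rep1 a') (rep2 a) \<noteq> {} \<and>
       (\<forall>\<kappa>\<in>transports n G emb Y K2 (rep1 a') (rep2 a).
          bij_betw (edge_map n Y K2 \<kappa>)
            {e \<in> arcs \<Gamma>1. tail \<Gamma>1 e = a' \<and> vertex_map n Y K2 (head \<Gamma>1 e) = b}
            {e \<in> arcs \<Gamma>2. tail \<Gamma>2 e = a \<and> head \<Gamma>2 e = b}))"
proof -
  have emb: "emb \<in> ring_hom type_ring type_ring" and dvr: "\<And>y. y \<in> Y \<Longrightarrow> dvr y"
    using assms(1,2) by (auto simp: smooth_projective_curve_def)
  interpret curve_points Y emb
    using emb dvr_valuation_ring[OF dvr] constants_in_closed_points[OF emb] assms(2)
    by unfold_locales auto
  let ?A = "ambient n Y" and ?Q = "rational_points n G emb Y"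
  let ?L1 = "local_level n G emb \<pi> D H1" and ?L2 = "local_level n G emb \<pi> D H2"
  interpret A: group ?A by (rule ambient_group)
  have G: "algebraic_group n G" using assms(4) by (simp add: connected_reductive_def)
  then have Greg: "G \<subseteq> regular_funs n" by (simp add: algebraic_group_def)
  have H: "algebraic_group n (H1 y)" "algebraic_group n (H2 y)" if "D y \<noteq> 0" for y
    using assms(10,11) that by (auto simp: ramification_datum_def algebraic_subgroup_def)
  have Hreg: "H1 y \<subseteq> regular_funs n" "H2 y \<subseteq> regular_funs n" if "D y \<noteq> 0" for y
    using H[OF that] by (simp_all add: algebraic_group_def)
  have \<pi>: "\<pi> y \<in> carrier (Ohat y)" if "y \<in> Y" for y
    using assms(8) that by (simp add: uniformizer_def)
  have \<mu>: "cocharacter n T \<mu>" using assms(7) by (simp add: dominant_cocharacter_def)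
  have T: "T \<subseteq> regular_funs n"
    using assms(5) by (simp add: split_maximal_torus_def split_torus_def algebraic_group_def)
  have d: "local_hecke n emb \<pi> x \<mu> \<in> carrier (GL n (Fhat x))"
    using assms(8) \<open>x \<in> Y\<close> by (intro local_hecke_GL[OF \<open>x \<in> Y\<close> _ \<mu> T]) simp
  note \<Delta> = assms(15)[unfolded adelic_hecke_local_element]
  have DA: "\<Delta> \<in> carrier ?A" and Dx: "component n x \<Delta> = local_hecke n emb \<pi> x \<mu>"
    using local_element[OF \<open>x \<in> Y\<close> d] \<open>x \<in> Y\<close> by (simp_all add: \<Delta>)
  have L: "subgroup (?L1 y) (GL n (Fhat y))" "subgroup (?L2 y) (GL n (Fhat y))" "?L1 y \<subseteq> ?L2 y" if "y \<in> Y" for y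
    using local_level_subgroup[of y \<pi> n G D, OF that \<pi>[OF that] G] H
      local_level_mono[of y \<pi> D H1 n H2 G, OF that \<pi>[OF that]] Hreg assms(12) by auto
  have K1: "K1 = restricted_product n Y ?L1" and K2: "K2 = restricted_product n Y ?L2"
    using level_group_eq[OF Greg] assms(13,14) by auto
  have K: "subgroup K1 ?A" "subgroup K2 ?A" "K1 \<subseteq> K2"
    using restricted_product_subgroup[of Y] L unfolding K1 K2 by blast+
  have Q: "subgroup ?Q ?A" by (rule rational_points_subgroup[OF G])
  \<comment> \<open>The hypothesis mentions the component of \<Delta> at \<open>x\<close>, so
    \<open>Dx\<close> is unfolded before \<Delta> itself is expanded.\<close>
  have bij: "bij_betw (\<lambda>C. C <#>\<^bsub>?A\<^esub> K2) (hecke_cosets ?A K1 \<Delta>) (hecke_cosets ?A K2 \<Delta>)"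
    using hecke_cosets_restricted_product[of x _ n ?L1 ?L2, OF \<open>x \<in> Y\<close> d L] assms(20)
    unfolding Dx unfolding K1 K2 \<Delta> by blast
  \<comment> \<open>Both vertex sets are indexed by the same adelic points, and the projection
    preserves the index; hence surjectivity.\<close>
  have ext: "vertex_map n Y K2 (?Q <#>\<^bsub>?A\<^esub> {g} <#>\<^bsub>?A\<^esub> K1) = ?Q <#>\<^bsub>?A\<^esub> {g} <#>\<^bsub>?A\<^esub> K2"
    if "g \<in> adelic_points n G emb Y" for g
    unfolding vertex_map_def using that adelic_points_ambient
    by (intro A.double_coset_extension K subgroup.subset[OF Q]) auto
  have V: "verts \<Gamma>1 = hecke_vertices n G emb Y K1" "verts \<Gamma>2 = hecke_vertices n G emb Y K2"
    by (simp_all add: assms(18,19) hecke_graph_def)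
  have surj: "vertex_map n Y K2 ` verts \<Gamma>1 = verts \<Gamma>2"
    using ext unfolding V hecke_vertices_def by (auto simp: image_image intro!: image_cong)
  have "transports n G emb Y K2 (rep1 a') (rep2 a) \<noteq> {} \<and>
       (\<forall>\<kappa>\<in>transports n G emb Y K2 (rep1 a') (rep2 a).
          bij_betw (edge_map n Y K2 \<kappa>)
            {e \<in> arcs \<Gamma>1. tail \<Gamma>1 e = a' \<and> vertex_map n Y K2 (head \<Gamma>1 e) = b}
            {e \<in> arcs \<Gamma>2. tail \<Gamma>2 e = a \<and> head \<Gamma>2 e = b})"
    if a: "a \<in> verts \<Gamma>2" and a': "a' \<in> verts \<Gamma>1" and eq: "vertex_map n Y K2 a' = a" for a b a'
  proof (intro conjI ballI)
    obtain g where g: "g \<in> adelic_points n G emb Y" "a' = ?Q <#>\<^bsub>?A\<^esub> {g} <#>\<^bsub>?A\<^esub> K1"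
      using a' by (auto simp: V hecke_vertices_def)
    have gA: "g \<in> carrier ?A" using g(1) adelic_points_ambient by blast
    have a_eq: "a = ?Q <#>\<^bsub>?A\<^esub> {g} <#>\<^bsub>?A\<^esub> K2" using ext[OF g(1)] eq g(2) by simp
    have r: "rep1 a' \<in> a'" "rep2 a \<in> a" "rep2 a \<in> carrier ?A"
      using assms(16,17) a a' adelic_points_ambient unfolding representatives_def V by blast+
    \<comment> \<open>Since \<open>K1 \<subseteq> K2\<close>, the class a' is contained in a, so
      both chosen representatives lie in one double coset of \<open>K2\<close>.\<close>
    have "rep1 a' \<in> ?Q <#>\<^bsub>?A\<^esub> {g} <#>\<^bsub>?A\<^esub> K2"
      using r(1) g(2) mono_set_mult[of "?Q <#>\<^bsub>?A\<^esub> {g}" "?Q <#>\<^bsub>?A\<^esub> {g}" K1 K2 ?A] K(3) by auto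
    moreover have "rep2 a \<in> ?Q <#>\<^bsub>?A\<^esub> {g} <#>\<^bsub>?A\<^esub> K2" using r(2) a_eq by simp
    ultimately obtain \<gamma> \<kappa> where "\<gamma> \<in> ?Q" "\<kappa> \<in> K2" "rep1 a' = \<gamma> \<otimes>\<^bsub>?A\<^esub> rep2 a \<otimes>\<^bsub>?A\<^esub> \<kappa>"
      by (rule A.double_coset_transport[OF Q K(2) gA])
    then show "transports n G emb Y K2 (rep1 a') (rep2 a) \<noteq> {}"
      unfolding transports_def by blast
  next
    fix \<kappa> assume "\<kappa> \<in> transports n G emb Y K2 (rep1 a') (rep2 a)"
    then obtain \<gamma> where \<kappa>: "\<gamma> \<in> ?Q" "\<kappa> \<in> K2" "rep1 a' = \<gamma> \<otimes>\<^bsub>?A\<^esub> rep2 a \<otimes>\<^bsub>?A\<^esub> \<kappa>"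
      by (auto simp: transports_def)
    have r: "rep2 a \<in> carrier ?A"
      using assms(17) a adelic_points_ambient unfolding representatives_def V by blast
    \<comment> \<open>Right multiplication by \<open>K2\<close> is \<open>vertex_map\<close>, so
      these are the labels of edges from a' to any lift of b.\<close>
    let ?E1 = "{C \<in> hecke_cosets ?A K1 \<Delta>. ?Q <#>\<^bsub>?A\<^esub> (rep1 a' <#\<^bsub>?A\<^esub> C) <#>\<^bsub>?A\<^esub> K2 = b}"
    let ?E2 = "{C \<in> hecke_cosets ?A K2 \<Delta>. ?Q <#>\<^bsub>?A\<^esub> (rep2 a <#\<^bsub>?A\<^esub> C) = b}"
    have "bij_betw (\<lambda>C. \<kappa> <#\<^bsub>?A\<^esub> (C <#>\<^bsub>?A\<^esub> K2)) ?E1 ?E2"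
      by (rule A.hecke_edges_bij[OF Q K DA bij r \<kappa>])
    \<comment> \<open>An arc is a pair of tail and label, and \<open>edge_map\<close> acts on each
      entry separately. With the tail fixed, only the bijection of labels remains.\<close>
    from bij_betw_Pair[OF this, of "vertex_map n Y K2" a']
    have "bij_betw (edge_map n Y K2 \<kappa>) ({a'} \<times> ?E1) ({a} \<times> ?E2)"
      by (simp add: edge_map_def eq)
    moreover have "{e \<in> arcs \<Gamma>1. tail \<Gamma>1 e = a' \<and> vertex_map n Y K2 (head \<Gamma>1 e) = b} = {a'} \<times> ?E1"
      using a' unfolding V by (auto simp: assms(18) hecke_graph_def vertex_map_def)
    moreover have "{e \<in> arcs \<Gamma>2. tail \<Gamma>2 e = a \<and> head \<Gamma>2 e = b} = {a} \<times> ?E2"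
      using a unfolding V by (auto simp: assms(19) hecke_graph_def)
    ultimately show "bij_betw (edge_map n Y K2 \<kappa>)
            {e \<in> arcs \<Gamma>1. tail \<Gamma>1 e = a' \<and> vertex_map n Y K2 (head \<Gamma>1 e) = b}
            {e \<in> arcs \<Gamma>2. tail \<Gamma>2 e = a \<and> head \<Gamma>2 e = b}" by simp
  qed
  then show ?thesis using surj by blast
qed

end
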